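(* Let $1<\beta\le2$ and $t\in\mathbb R$. For $\lambda\in\mathbb C$ with $|\lambda|>r_t$, $\lambda$ is an isolated eigenvalue of $\mathcal L_t:\mathcal F\to\mathcal F$ if and only if $\lambda^{-1}$ is a zero of $1-\phi_t(z)$, where $\phi_t(z)=\sum_{n=1}^\infty q_n(1)H_{n-1}(t,\underline1)z^n$.
   Context: For $1<\beta\le2$, $\tau_\beta(x)=\beta x-[\beta x]$ on $[0,1]$ and $g_n(x)=[\beta\tau_\beta^{n-1}(x)]$ are the greedy digits of $x$. $\{0,1\}^{\mathbb N}$ carries the product topology, the lexicographic order $\preceq$ and the left shift $\sigma$. $\underline0=000\cdots$ and $\underline1=(q_n(1))_{n\ge1}:=\lim_{y\nearrow1}(g_n(y))_{n\ge1}$ (quasi-greedy expansion of $1$). The beta-shift is $X_\beta=\{\underline x\in\{0,1\}^{\mathbb N}:\sigma^n(\underline x)\preceq\underline1\ \forall n\ge0\}$ with the map $\sigma$. Function spaces: for $f:X_\beta\to\mathbb C$, $\mathrm{var}(f)$ is the supremum of $\sum_{i=1}^n|f(x_i)-f(x_{i-1})|$ over finite chains $\underline0=x_0\prec x_1\prec\dots\prec x_n=\underline1$ in $X_\beta$; $BV=\{f:\mathrm{var}(f)<\infty\}$ with norm $\|f\|_{BV}=|f|_\infty+\mathrm{var}(f)$, $|f|_\infty=\sup|f|$. $\mathcal N$ is the set of $f\in BV$ vanishing off a countable set, $\mathcal B=BV/\mathcal N$ with the quotient norm, and $\mathcal F\subset\mathcal B$ is the closure in $\mathcal B$ of the linear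 span of indicator functions of intervals in $X_\beta$. Operator: $C_1=\{(x_i)\in X_\beta:x_1=1\}$, $\chi_{C_1}$ its indicator function; $\mathcal L_tf(x)=\sum_{y:\sigma(y)=x}e^{t\chi_{C_1}(y)}f(y)$, a bounded operator on $\mathcal F$. $r_t=\limsup_{n\to\infty}|e^{tS_n\chi_{C_1}}|_\infty^{1/n}$ with $S_nf=\sum_{i=0}^{n-1}f\circ\sigma^i$. For $\underline x=(x_i)\in X_\beta$: $H_0(t,\underline x)=1$, $H_n(t,\underline x)=\exp(t\sum_{i=1}^nx_i)$ for $n\ge1$. The power series $\phi_t$ has radius of convergence at least $r_t^{-1}$. *)

theory Defs
  imports "HOL-Analysis.Analysis" "HOL-Library.Fun_Lexorder"
begin

section \<open>Beta-shifts\<close>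

text \<open>Digit sequences are indexed from 0: the paper's \<open>x\<^sub>i\<close> (\<open>i \<ge> 1\<close>) is \<open>x (i - 1)\<close>.\<close>

type_synonym digits = "nat \<Rightarrow> nat"

definition tau :: "real \<Rightarrow> real \<Rightarrow> real" where
  "tau \<beta> x = \<beta> * x - of_int \<lfloor>\<beta> * x\<rfloor>"

definition greedy :: "real \<Rightarrow> real \<Rightarrow> digits" where
  "greedy \<beta> x = (\<lambda>n. nat \<lfloor>\<beta> * (tau \<beta> ^^ n) x\<rfloor>)"

text \<open>The left limit is taken in the product topology on \<^typ>\<open>nat \<Rightarrow> nat\<close>,
  with \<^typ>\<open>nat\<close> discrete.\<close>

definition quasi_one :: "real \<Rightarrow> digits" where
  "quasi_one \<beta> = (THE q. (greedy \<beta> \<longlongrightarrow> q) (at_left 1))"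

definition zero_digits :: digits where
  "zero_digits = (\<lambda>_. 0)"

definition shift :: "digits \<Rightarrow> digits" where
  "shift x = (\<lambda>i. x (Suc i))"

definition lex_le :: "digits \<Rightarrow> digits \<Rightarrow> bool" where
  "lex_le x y \<longleftrightarrow> less_fun x y \<or> x = y"

definition beta_shift :: "real \<Rightarrow> digits set" where
  "beta_shift \<beta> = {x. (\<forall>i. x i \<in> {0, 1}) \<and> (\<forall>n. lex_le ((shift ^^ n) x) (quasi_one \<beta>))}"


section \<open>Functions of bounded variation on the beta-shift\<close>

text \<open>A function on \<^term>\<open>beta_shift \<beta>\<close> is represented by its extension by 0 to all digit
  sequences.\<close>

definition sup_norm :: "real \<Rightarrow> (digits \<Rightarrow> 'a::real_normed_vector) \<Rightarrow> real" where
  "sup_norm \<beta> f = (SUP x\<in>beta_shift \<beta>. norm (f x))"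

definition full_chain :: "real \<Rightarrow> nat \<Rightarrow> (nat \<Rightarrow> digits) \<Rightarrow> bool" where
  "full_chain \<beta> n c \<longleftrightarrow> c 0 = zero_digits \<and> c n = quasi_one \<beta> \<and>
     (\<forall>i\<le>n. c i \<in> beta_shift \<beta>) \<and> (\<forall>i<n. less_fun (c i) (c (Suc i)))"

definition variation_sums :: "real \<Rightarrow> (digits \<Rightarrow> complex) \<Rightarrow> real set" where
  "variation_sums \<beta> f = {\<Sum>i<n. cmod (f (c (Suc i)) - f (c i)) | n c. full_chain \<beta> n c}"

definition variation :: "real \<Rightarrow> (digits \<Rightarrow> complex) \<Rightarrow> real" where
  "variation \<beta> f = Sup (variation_sums \<beta> f)"

definition BV :: "real \<Rightarrow> (digits \<Rightarrow> complex) set" where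
  "BV \<beta> = {f. (\<forall>x. x \<notin> beta_shift \<beta> \<longrightarrow> f x = 0) \<and> bdd_above (variation_sums \<beta> f)}"

definition bv_norm :: "real \<Rightarrow> (digits \<Rightarrow> complex) \<Rightarrow> real" where
  "bv_norm \<beta> f = sup_norm \<beta> f + variation \<beta> f"

definition BV_null :: "real \<Rightarrow> (digits \<Rightarrow> complex) set" where
  "BV_null \<beta> = {f \<in> BV \<beta>. countable {x \<in> beta_shift \<beta>. f x \<noteq> 0}}"


section \<open>The quotient space and its subspace generated by intervals\<close>

definition BV_rel :: "real \<Rightarrow> ((digits \<Rightarrow> complex) \<times> (digits \<Rightarrow> complex)) set" where
  "BV_rel \<beta> = {(f, g). f \<in> BV \<beta> \<and> g \<in> BV \<beta> \<and> (\<lambda>x. f x - g x) \<in> BV_null \<beta>}"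

definition cls :: "real \<Rightarrow> (digits \<Rightarrow> complex) \<Rightarrow> (digits \<Rightarrow> complex) set" where
  "cls \<beta> f = BV_rel \<beta> `` {f}"

definition BV_quot :: "real \<Rightarrow> (digits \<Rightarrow> complex) set set" where
  "BV_quot \<beta> = BV \<beta> // BV_rel \<beta>"

definition zero_cls :: "real \<Rightarrow> (digits \<Rightarrow> complex) set" where
  "zero_cls \<beta> = cls \<beta> (\<lambda>_. 0)"

definition diff_cls ::
    "real \<Rightarrow> (digits \<Rightarrow> complex) set \<Rightarrow> (digits \<Rightarrow> complex) set \<Rightarrow> (digits \<Rightarrow> complex) set" where
  "diff_cls \<beta> A B = (\<Union>f\<in>A. \<Union>g\<in>B. cls \<beta> (\<lambda>x. f x - g x))"

definition scale_cls ::
    "real \<Rightarrow> complex \<Rightarrow> (digits \<Rightarrow> complex) set \<Rightarrow> (digits \<Rightarrow> complex) set" where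
  "scale_cls \<beta> c A = (\<Union>f\<in>A. cls \<beta> (\<lambda>x. c * f x))"

text \<open>Since the members of a class are the \<open>f + h\<close> with \<open>h\<close> in \<^term>\<open>BV_null \<beta>\<close>, this is the
  usual quotient norm.\<close>

definition quot_norm :: "real \<Rightarrow> (digits \<Rightarrow> complex) set \<Rightarrow> real" where
  "quot_norm \<beta> A = (INF f\<in>A. bv_norm \<beta> f)"

text \<open>Intervals are the order-convex subsets, with or without their endpoints; singletons and
  the empty set are allowed.\<close>

definition shift_interval :: "real \<Rightarrow> digits set \<Rightarrow> bool" where
  "shift_interval \<beta> I \<longleftrightarrow> I \<subseteq> beta_shift \<beta> \<and>
     (\<forall>x\<in>I. \<forall>y\<in>I. \<forall>z\<in>beta_shift \<beta>. less_fun x z \<and> less_fun z y \<longrightarrow> z \<in> I)"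

definition interval_span :: "real \<Rightarrow> (digits \<Rightarrow> complex) set" where
  "interval_span \<beta> =
     {\<lambda>x. \<Sum>i<n. a i * indicator (I i) x | (n::nat) a I. \<forall>i<n. shift_interval \<beta> (I i)}"

definition F_space :: "real \<Rightarrow> (digits \<Rightarrow> complex) set set" where
  "F_space \<beta> = {A \<in> BV_quot \<beta>.
     \<forall>\<epsilon>>0. \<exists>f\<in>interval_span \<beta>. quot_norm \<beta> (diff_cls \<beta> A (cls \<beta> f)) < \<epsilon>}"


section \<open>The transfer operator\<close>

definition cyl1 :: "real \<Rightarrow> digits set" where
  "cyl1 \<beta> = {x \<in> beta_shift \<beta>. x 0 = 1}"

definition transfer_fun ::
    "real \<Rightarrow> real \<Rightarrow> (digits \<Rightarrow> complex) \<Rightarrow> (digits \<Rightarrow> complex)" where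
  "transfer_fun \<beta> t f =
     (\<lambda>x. \<Sum>y | y \<in> beta_shift \<beta> \<and> shift y = x. of_real (exp (t * indicator (cyl1 \<beta>) y)) * f y)"

definition transfer_op ::
    "real \<Rightarrow> real \<Rightarrow> (digits \<Rightarrow> complex) set \<Rightarrow> (digits \<Rightarrow> complex) set" where
  "transfer_op \<beta> t A = (\<Union>f\<in>A. cls \<beta> (transfer_fun \<beta> t f))"

definition birkhoff :: "nat \<Rightarrow> (digits \<Rightarrow> real) \<Rightarrow> digits \<Rightarrow> real" where
  "birkhoff n f x = (\<Sum>i<n. f ((shift ^^ i) x))"

definition growth_rate :: "real \<Rightarrow> real \<Rightarrow> ereal" where
  "growth_rate \<beta> t =
     limsup (\<lambda>n. ereal (root n (sup_norm \<beta> (\<lambda>x. exp (t * birkhoff n (indicator (cyl1 \<beta>)) x)))))"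

definition op_minus ::
    "real \<Rightarrow> real \<Rightarrow> complex \<Rightarrow> (digits \<Rightarrow> complex) set \<Rightarrow> (digits \<Rightarrow> complex) set" where
  "op_minus \<beta> t \<mu> A = diff_cls \<beta> (transfer_op \<beta> t A) (scale_cls \<beta> \<mu> A)"

text \<open>\<open>\<mu>\<close> lies outside the spectrum iff \<open>L\<^sub>t - \<mu>\<close> is a bijection of \<^term>\<open>F_space \<beta>\<close> with
  bounded inverse; the second conjunct below is the boundedness of the inverse.\<close>

definition op_spectrum :: "real \<Rightarrow> real \<Rightarrow> complex set" where
  "op_spectrum \<beta> t = {\<mu>. \<not> (bij_betw (op_minus \<beta> t \<mu>) (F_space \<beta>) (F_space \<beta>) \<and>
     (\<exists>K. \<forall>A\<in>F_space \<beta>. quot_norm \<beta> A \<le> K * quot_norm \<beta> (op_minus \<beta> t \<mu> A)))}"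

definition op_eigenvalue :: "real \<Rightarrow> real \<Rightarrow> complex \<Rightarrow> bool" where
  "op_eigenvalue \<beta> t \<mu> \<longleftrightarrow>
     (\<exists>A\<in>F_space \<beta>. A \<noteq> zero_cls \<beta> \<and> transfer_op \<beta> t A = scale_cls \<beta> \<mu> A)"

definition isolated_eigenvalue :: "real \<Rightarrow> real \<Rightarrow> complex \<Rightarrow> bool" where
  "isolated_eigenvalue \<beta> t \<mu> \<longleftrightarrow> op_eigenvalue \<beta> t \<mu> \<and> \<mu> isolated_in op_spectrum \<beta> t"


section \<open>The power series\<close>

definition H :: "nat \<Rightarrow> real \<Rightarrow> digits \<Rightarrow> real" where
  "H n t x = exp (t * (\<Sum>i<n. real (x i)))"

definition phi :: "real \<Rightarrow> real \<Rightarrow> complex \<Rightarrow> complex" where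
  "phi \<beta> t z =
     (\<Sum>n. of_nat (quasi_one \<beta> n) * of_real (H n t (quasi_one \<beta>)) * z ^ Suc n)"

end

theory Submission
  imports Defs "HOL-Complex_Analysis.Conformal_Mappings"
begin

text \<open>Let \<open>q\<close> be the quasi-greedy expansion of 1, \<open>Q\<close> the set of points of the beta-shift with
  infinitely many ones, and \<open>e\<^sub>p\<close> the indicator function of \<open>{x. x \<le> p}\<close>. Modulo countable sets every
  interval is a difference of two such sets with \<open>p\<close> in \<open>Q\<close>, and any two points of \<open>Q\<close> are separated
  by uncountably many points; hence \<open>a \<mapsto> \<Sum> a\<^sub>p e\<^sub>p\<close> is an isomorphism of \<open>\<ell>\<^sup>1(Q)\<close> onto \<open>\<F>\<close>. Under it
  the transfer operator becomes \<open>W + \<lambda> \<otimes> e\<^sub>q\<close>, where \<open>W e\<^sub>p = exp (t p\<^sub>0) e\<^bsub>\<sigma> p\<^esub>\<close> and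
  \<open>\<lambda>(e\<^sub>p) = p\<^sub>0\<close>. As \<open>\<parallel>W\<^sup>n\<parallel>\<close> is bounded by the supremum of \<open>exp (t S\<^sub>n)\<close>, the resolvent of \<open>W\<close> exists
  for \<open>\<bar>\<mu>\<bar> > r\<^sub>t\<close>, and a rank-one perturbation argument shows that \<open>\<mu>\<close> is an eigenvalue if
  \<open>\<lambda>((\<mu> - W)\<^sup>-\<^sup>1 e\<^sub>q) = 1\<close> and lies outside the spectrum otherwise. The Neumann series identifies the
  left-hand side with \<open>\<phi>\<^sub>t(1/\<mu>)\<close>, whose 1-points are isolated.\<close>

section \<open>The lexicographic order\<close>

text \<open>The coordinates are faithful because the quotient norm is equivalent to the l1 norm of
  the jumps, with constants 1 and 2. The lower bound is the delicate half, since values at single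
  points mean nothing in the quotient: a representative is sampled in every gap between consecutive
  jumps, off its countable exceptional set. Its variation then sees all jumps but the last, and its
  sup norm sees that one. Jumps outside \<open>Q\<close> would spoil uniqueness: such a point is
  either \<open>zero_digits\<close>, whose indicator is carried by one point, or has an immediate
  predecessor, whose indicator differs from its own at one point only.

  The vector \<open>e_q\<close> is the constant 1 on the shift. It arises because every
  \<open>0x\<close> lies below a \<open>p\<close> that begins with 1.

  With \<open>R\<close> the inverse of \<open>\<mu> - W\<close> and \<open>u = R e_q\<close>, the
  equation \<open>(L - \<mu>) a = c\<close> reads \<open>a = \<lambda>(a) u - R c\<close>. Applying
  \<open>\<lambda>\<close> leaves one scalar equation,
  \<open>(1 - \<lambda>(u)) \<lambda>(a) = - \<lambda>(R c)\<close>, so everything hinges on whether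
  \<open>\<lambda>(u) = 1\<close>.\<close>

lemma lex_linear:
  fixes x y :: digits
  shows "less_fun x y \<or> x = y \<or> less_fun y x"
proof (cases "x = y")
  case False
  define k where "k = (LEAST k. x k \<noteq> y k)"
  from False have "\<exists>k. x k \<noteq> y k" by auto
  then have k: "x k \<noteq> y k" unfolding k_def by (rule LeastI_ex)
  have eq: "x j = y j" if "j < k" for j
    using not_less_Least[of j "\<lambda>k. x k \<noteq> y k"] that unfolding k_def by blast
  show ?thesis
  proof (cases "x k < y k")
    case True
    then show ?thesis using eq by (auto intro!: less_funI)
  next
    case False
    then have "y k < x k" using k by simp
    then show ?thesis using eq by (auto intro!: less_funI)
  qed
qed simp

interpretation lex: linorder lex_le less_fun
  using lex_linear
  by unfold_locales (auto simp: lex_le_def less_fun_irrefl dest: less_fun_asym less_fun_trans)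

lemma shift_pow: "(shift ^^ n) x = (\<lambda>i. x (i + n))"
  by (induction n) (auto simp: shift_def)

lemma shift_pow_apply [simp]: "(shift ^^ n) x i = x (i + n)"
  by (simp add: shift_pow)

lemma lex_le_prefix:
  assumes "\<And>i. i < n \<Longrightarrow> x i = y i" "lex_le ((shift ^^ n) x) ((shift ^^ n) y)"
  shows "lex_le x y"
proof (cases "(shift ^^ n) x = (shift ^^ n) y")
  case True
  have "x i = y i" for i
  proof (cases "i < n")
    case False
    then show ?thesis using fun_cong[OF True, of "i - n"] by simp
  qed (use assms in auto)
  then show ?thesis by (auto simp: lex_le_def)
next
  case False
  with assms obtain k where k: "x (k + n) < y (k + n)" "\<And>j. j < k \<Longrightarrow> x (j + n) = y (j + n)"
    by (auto simp: lex_le_def elim!: less_funE)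
  have "x j = y j" if "j < k + n" for j
  proof (cases "j < n")
    case False
    then show ?thesis using k(2)[of "j - n"] that by simp
  qed (use assms in auto)
  then show ?thesis using k(1) by (auto simp: lex_le_def intro!: less_funI)
qed

section \<open>The quasi-greedy expansion of 1\<close>

text \<open>The left limit of \<^const>\<open>tau\<close>; it maps \<open>(0, 1]\<close> to itself.\<close>

definition tau_left :: "real \<Rightarrow> real \<Rightarrow> real" where
  "tau_left \<beta> x = \<beta> * x - of_int (\<lceil>\<beta> * x\<rceil> - 1)"

text \<open>The left limit of the floor function at \<open>v\<close> is
  \<open>\<lceil>v\<rceil> - 1\<close>, so these are the digits that \<open>greedy\<close> shows
  immediately to the left of \<open>x\<close>.\<close>

definition qgreedy :: "real \<Rightarrow> real \<Rightarrow> digits" where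
  "qgreedy \<beta> x = (\<lambda>n. nat (\<lceil>\<beta> * (tau_left \<beta> ^^ n) x\<rceil> - 1))"

locale beta_expansion =
  fixes \<beta> :: real
  assumes beta_gt: "1 < \<beta>" and beta_le: "\<beta> \<le> 2"
begin

lemma tau_left_range: "0 < tau_left \<beta> x" "tau_left \<beta> x \<le> 1"
  unfolding tau_left_def by linarith+

lemma tau_left_pow_range:
  assumes "0 < x" "x \<le> 1"
  shows "0 < (tau_left \<beta> ^^ n) x" "(tau_left \<beta> ^^ n) x \<le> 1"
  using assms tau_left_range by (cases n; simp)+

lemma eventually_floor:
  "eventually (\<lambda>y. \<lfloor>\<beta> * y\<rfloor> = \<lceil>\<beta> * x\<rceil> - 1) (at_left x)"
proof -
  \<comment> \<open>\<open>b\<close> is the largest point below \<open>x\<close> at which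
    \<open>\<beta> * y\<close> is an integer; the floor is constant between \<open>b\<close> and
    \<open>x\<close>.\<close>
  define b where "b = real_of_int (\<lceil>\<beta> * x\<rceil> - 1) / \<beta>"
  have "b < x" unfolding b_def using beta_gt by (simp add: divide_simps mult.commute) linarith
  then have "eventually (\<lambda>y. y \<in> {b<..<x}) (at_left x)"
    using eventually_at_left_real by blast
  then show ?thesis
  proof eventually_elim
    case (elim y)
    have "real_of_int (\<lceil>\<beta> * x\<rceil> - 1) < \<beta> * y"
      using elim beta_gt unfolding b_def by (simp add: divide_simps mult.commute)
    moreover have "\<beta> * y < \<beta> * x" using elim beta_gt by simp
    ultimately show ?case by linarith
  qed
qed

text \<open>Just left of \<open>x\<close> the map \<open>tau\<close> is affine with positive slope,
  so it stays strictly below its left limit. The one-sided target filter is what allows limits to be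
  composed along the orbit.\<close>

lemma filterlim_tau: "filterlim (tau \<beta>) (at_left (tau_left \<beta> x)) (at_left x)"
proof (rule tendsto_imp_filterlim_at_left)
  have ev: "eventually (\<lambda>y. \<beta> * y - of_int (\<lceil>\<beta> * x\<rceil> - 1) = tau \<beta> y) (at_left x)"
    using eventually_floor by eventually_elim (simp add: tau_def)
  have "((\<lambda>y. \<beta> * y - of_int (\<lceil>\<beta> * x\<rceil> - 1)) \<longlongrightarrow> tau_left \<beta> x) (at_left x)"
    unfolding tau_left_def by (intro tendsto_intros)
  then show "(tau \<beta> \<longlongrightarrow> tau_left \<beta> x) (at_left x)"
    using ev by (rule Lim_transform_eventually)
  have "eventually (\<lambda>y. y < x) (at_left x)" by (simp add: eventually_at_filter)
  then show "eventually (\<lambda>y. tau \<beta> y < tau_left \<beta> x) (at_left x)"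
    using ev
  proof eventually_elim
    case (elim y)
    have "\<beta> * y < \<beta> * x" using elim beta_gt by simp
    then show ?case using elim unfolding tau_left_def by linarith
  qed
qed

lemma filterlim_tau_pow:
  "filterlim (tau \<beta> ^^ n) (at_left ((tau_left \<beta> ^^ n) x)) (at_left x)"
proof (induction n)
  case (Suc n)
  show ?case using filterlim_compose[OF filterlim_tau Suc] by (simp add: o_def)
qed (simp add: filterlim_ident id_def)

lemma tendsto_greedy: "(greedy \<beta> \<longlongrightarrow> qgreedy \<beta> x) (at_left x)"
proof -
  have "((\<lambda>y. greedy \<beta> y n) \<longlongrightarrow> qgreedy \<beta> x n) (at_left x)" for n
  proof (rule tendsto_eventually)
    have "eventually (\<lambda>y. \<lfloor>\<beta> * (tau \<beta> ^^ n) y\<rfloor> = \<lceil>\<beta> * (tau_left \<beta> ^^ n) x\<rceil> - 1) (at_left x)"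
      by (rule eventually_compose_filterlim[OF eventually_floor filterlim_tau_pow])
    then show "eventually (\<lambda>y. greedy \<beta> y n = qgreedy \<beta> x n) (at_left x)"
      by eventually_elim (simp add: greedy_def qgreedy_def)
  qed
  then have "limitin (product_topology (\<lambda>_. euclidean) UNIV) (greedy \<beta>) (qgreedy \<beta> x) (at_left x)"
    by (simp add: limitin_componentwise)
  then show ?thesis by (simp add: euclidean_product_topology)
qed

lemma quasi_one_eq: "quasi_one \<beta> = qgreedy \<beta> 1"
  unfolding quasi_one_def
proof (rule the_equality)
  fix r assume "(greedy \<beta> \<longlongrightarrow> r) (at_left 1)"
  then have "limitin (product_topology (\<lambda>_. euclidean) UNIV) (greedy \<beta>) r (at_left 1)"
    by (simp add: euclidean_product_topology)
  then have r: "((\<lambda>y. greedy \<beta> y n) \<longlongrightarrow> r n) (at_left 1)" for n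
    by (simp add: limitin_componentwise)
  have "limitin (product_topology (\<lambda>_. euclidean) UNIV) (greedy \<beta>) (qgreedy \<beta> 1) (at_left 1)"
    using tendsto_greedy by (simp add: euclidean_product_topology)
  then have "((\<lambda>y. greedy \<beta> y n) \<longlongrightarrow> qgreedy \<beta> 1 n) (at_left 1)" for n
    by (simp add: limitin_componentwise)
  then show "r = qgreedy \<beta> 1"
    using tendsto_unique[OF trivial_limit_at_left_real r] by (intro ext) auto
qed (rule tendsto_greedy)

lemma qgreedy_shift: "(shift ^^ n) (qgreedy \<beta> x) = qgreedy \<beta> ((tau_left \<beta> ^^ n) x)"
  by (auto simp: fun_eq_iff qgreedy_def funpow_add)

lemma qgreedy_digit:
  assumes "0 < x" "x \<le> 1"
  shows "qgreedy \<beta> x n \<in> {0, 1}"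
proof -
  define v where "v = (tau_left \<beta> ^^ n) x"
  have v: "0 < v" "v \<le> 1" unfolding v_def using tau_left_pow_range assms by blast+
  have "\<beta> * v \<le> 2 * 1" using v beta_le beta_gt by (intro mult_mono) auto
  moreover have "0 < \<beta> * v" using v beta_gt by simp
  ultimately have "\<lceil>\<beta> * v\<rceil> - 1 = 0 \<or> \<lceil>\<beta> * v\<rceil> - 1 = 1" by linarith
  then have "nat (\<lceil>\<beta> * v\<rceil> - 1) = 0 \<or> nat (\<lceil>\<beta> * v\<rceil> - 1) = 1"
    by (metis One_nat_def nat_0 nat_1)
  then show ?thesis unfolding qgreedy_def v_def[symmetric] by simp
qed

lemma tau_left_pow_Suc:
  assumes "0 < x" "x \<le> 1"
  shows "(tau_left \<beta> ^^ Suc n) x = \<beta> * (tau_left \<beta> ^^ n) x - qgreedy \<beta> x n"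
proof -
  have "0 < \<beta> * (tau_left \<beta> ^^ n) x" using tau_left_pow_range[OF assms] beta_gt by simp
  then show ?thesis by (simp add: tau_left_def qgreedy_def)
qed

text \<open>As long as the digits agree, both orbits are moved by the same increasing affine map.
  The order of the orbit points therefore survives up to the first differing digit and decides
  it.\<close>

lemma qgreedy_mono:
  assumes "0 < x" "x \<le> y" "y \<le> 1"
  shows "lex_le (qgreedy \<beta> x) (qgreedy \<beta> y)"
proof (cases "qgreedy \<beta> x = qgreedy \<beta> y")
  case False
  define d e where "d = qgreedy \<beta> x" and "e = qgreedy \<beta> y"
  define k where "k = (LEAST k. d k \<noteq> e k)"
  from False have "\<exists>k. d k \<noteq> e k" by (auto simp: d_def e_def)
  then have k: "d k \<noteq> e k" unfolding k_def by (rule LeastI_ex)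
  have eq: "d j = e j" if "j < k" for j
    using not_less_Least[of j "\<lambda>k. d k \<noteq> e k"] that unfolding k_def by blast
  have le: "(tau_left \<beta> ^^ j) x \<le> (tau_left \<beta> ^^ j) y" if "j \<le> k" for j
    using that
  proof (induction j)
    case (Suc j)
    then have "(tau_left \<beta> ^^ j) x \<le> (tau_left \<beta> ^^ j) y" "d j = e j" using eq by auto
    moreover have "0 < y" "x \<le> 1" using assms by auto
    ultimately show ?case
      using beta_gt assms unfolding tau_left_pow_Suc[OF assms(1) \<open>x \<le> 1\<close>]
        tau_left_pow_Suc[OF \<open>0 < y\<close> assms(3)] d_def e_def by simp
  qed (use assms in auto)
  have "d k \<le> e k" unfolding d_def e_def qgreedy_def
    using le[of k] beta_gt by (intro nat_mono diff_right_mono ceiling_mono) auto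
  then have "less_fun d e" using k eq by (intro less_funI exI[of _ k]) auto
  then show ?thesis unfolding lex_le_def d_def e_def by blast
qed simp

lemma quasi_one_digit: "quasi_one \<beta> n = 0 \<or> quasi_one \<beta> n = 1"
  using qgreedy_digit[of 1 n] unfolding quasi_one_eq by simp

lemma quasi_one_0: "quasi_one \<beta> 0 = 1"
proof -
  have "\<lceil>\<beta>\<rceil> = 2" using beta_gt beta_le by linarith
  then show ?thesis by (simp add: quasi_one_eq qgreedy_def)
qed

text \<open>Shifting moves the base point along the \<open>tau_left\<close> orbit of 1, which never
  exceeds 1, so monotonicity of the expansion applies.\<close>

lemma quasi_one_shift_le: "lex_le ((shift ^^ n) (quasi_one \<beta>)) (quasi_one \<beta>)"
  unfolding quasi_one_eq qgreedy_shift
  using tau_left_pow_range[of 1 n] by (intro qgreedy_mono) auto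

text \<open>If all digits from \<open>n\<close> on were 0, each further step would multiply the
  positive orbit point by \<open>\<beta> > 1\<close>, and the orbit would leave
  \<open>(0, 1]\<close>.\<close>

lemma quasi_one_infinite_ones: "\<exists>m\<ge>n. quasi_one \<beta> m = 1"
proof (rule ccontr)
  assume "\<not> (\<exists>m\<ge>n. quasi_one \<beta> m = 1)"
  then have z: "qgreedy \<beta> 1 m = 0" if "m \<ge> n" for m
    using quasi_one_digit[of m] that by (auto simp: quasi_one_eq)
  define v where "v = (tau_left \<beta> ^^ n) 1"
  have v: "0 < v" unfolding v_def using tau_left_pow_range[of 1 n] by simp
  have eq: "(tau_left \<beta> ^^ (n + k)) 1 = \<beta> ^ k * v" for k
  proof (induction k)
    case (Suc k)
    then show ?case using tau_left_pow_Suc[of 1 "n + k"] z[of "n + k"] by simp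
  qed (simp add: v_def)
  obtain k where "1 / v < \<beta> ^ k" using real_arch_pow[OF beta_gt] by blast
  then have "1 < \<beta> ^ k * v" using v by (simp add: field_simps)
  then show False using eq[of k] tau_left_pow_range[of 1 "n + k"] by simp
qed

end

section \<open>Combinatorics of the beta-shift\<close>

lemma zero_digits_le: "lex_le zero_digits x"
proof (cases "x = zero_digits")
  case False
  have "\<not> less_fun x zero_digits" by (auto simp: zero_digits_def less_fun_def)
  then show ?thesis by (simp add: lex.not_less)
qed simp

definition cons :: "nat \<Rightarrow> digits \<Rightarrow> digits" where
  "cons d r = case_nat d r"

lemma cons_simps [simp]: "cons d r 0 = d" "cons d r (Suc i) = r i" "shift (cons d r) = r"
  by (auto simp: cons_def shift_def)

lemma cons_shift: "cons (x 0) (shift x) = x"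
  by (auto simp: fun_eq_iff cons_def shift_def split: nat.split)

lemma cons_eq_iff: "cons d x = y \<longleftrightarrow> y 0 = d \<and> x = shift y"
  using cons_shift cons_simps by metis

lemma less_fun_iff_shift: "less_fun x y \<longleftrightarrow> x 0 < y 0 \<or> (x 0 = y 0 \<and> less_fun (shift x) (shift y))"
  (is "?l \<longleftrightarrow> ?r")
proof
  assume ?l
  then obtain k where k: "x k < y k" "\<And>j. j < k \<Longrightarrow> x j = y j" by (auto elim!: less_funE)
  then show ?r by (cases k) (auto simp: shift_def intro!: less_funI)
next
  assume ?r
  then show ?l
  proof
    assume "x 0 = y 0 \<and> less_fun (shift x) (shift y)"
    then obtain k where "x (Suc k) < y (Suc k)" "\<And>j. j < k \<Longrightarrow> x (Suc j) = y (Suc j)" "x 0 = y 0"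
      by (auto simp: shift_def elim!: less_funE)
    then show ?l by (intro less_funI exI[of _ "Suc k"]) (auto simp: less_Suc_eq_0_disj)
  qed (auto intro: less_funI)
qed

lemma lex_le_iff_shift: "lex_le x y \<longleftrightarrow> x 0 < y 0 \<or> (x 0 = y 0 \<and> lex_le (shift x) (shift y))"
  using less_fun_iff_shift cons_shift unfolding lex_le_def by metis

lemma less_fun_shift_pow:
  assumes "x k < y k" "\<And>j. j < k \<Longrightarrow> x j = y j" "n \<le> k"
  shows "less_fun ((shift ^^ n) x) ((shift ^^ n) y)"
  using assms by (intro less_funI exI[of _ "k - n"]) auto

text \<open>A strict inequality is decided at a finite position, so the set of points above
  \<open>x\<close> is open.\<close>

lemma less_fun_prefix:
  assumes "less_fun x y"
  obtains k where "\<And>z. (\<And>i. i \<le> k \<Longrightarrow> z i = y i) \<Longrightarrow> less_fun x z"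
proof -
  from assms obtain k where "x k < y k" "\<And>j. j < k \<Longrightarrow> x j = y j" by (auto elim!: less_funE)
  then show ?thesis by (intro that[of k]) (auto intro!: less_funI exI[of _ k])
qed

text \<open>Meant for \<open>b m = 1\<close>: that digit is lowered to 0, after which any admissible
  tail \<open>y\<close> may follow. This produces points just below \<open>b\<close>.\<close>

definition splice_zero :: "nat \<Rightarrow> digits \<Rightarrow> digits \<Rightarrow> digits" where
  "splice_zero m b y = (\<lambda>i. if i < m then b i else if i = m then 0 else y (i - Suc m))"

lemma splice_zero_inj: "splice_zero m b y = splice_zero m b z \<Longrightarrow> y = z"
proof
  fix i assume "splice_zero m b y = splice_zero m b z"
  from fun_cong[OF this, of "i + Suc m"] show "y i = z i" by (simp add: splice_zero_def)
qed

lemma shift_pow_splice_zero: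
  "n > m \<Longrightarrow> (shift ^^ n) (splice_zero m b y) = (shift ^^ (n - Suc m)) y"
  by (auto simp: fun_eq_iff splice_zero_def)

lemma splice_zero_less:
  assumes "b m = 1"
  shows "less_fun (splice_zero m b y) b"
  using assms by (intro less_funI exI[of _ m]) (auto simp: splice_zero_def)

lemma uncountable_nat_sets: "uncountable (UNIV :: nat set set)"
proof
  assume "countable (UNIV :: nat set set)"
  then have "range (from_nat_into (UNIV :: nat set set)) = UNIV"
    by (simp add: range_from_nat_into)
  then show False using Cantors_theorem[of "UNIV :: nat set"] by auto
qed

section \<open>Admissible sequences, inverse branches of the shift, gaps in the order\<close>

context beta_expansion
begin

abbreviation "X \<equiv> beta_shift \<beta>"
abbreviation "q \<equiv> quasi_one \<beta>"

text \<open>Apart from \<open>zero_digits\<close>, these are exactly the points of \<open>X\<close>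
  without an immediate predecessor: see \<open>uncountable_between\<close> and
  \<open>Q_predecessor\<close>.\<close>

definition "Q = {p \<in> X. \<forall>n. \<exists>m\<ge>n. p m = 1}"

lemma XI: "(\<And>i. x i = 0 \<or> x i = 1) \<Longrightarrow> (\<And>n. lex_le ((shift ^^ n) x) q) \<Longrightarrow> x \<in> X"
  by (auto simp: beta_shift_def)

lemma X_digit: "x \<in> X \<Longrightarrow> x i = 0 \<or> x i = 1"
  by (auto simp: beta_shift_def)

lemma X_shift_pow_le: "x \<in> X \<Longrightarrow> lex_le ((shift ^^ n) x) q"
  by (auto simp: beta_shift_def)

lemma X_le: "x \<in> X \<Longrightarrow> lex_le x q"
  using X_shift_pow_le[of x 0] by simp

lemma q_in_X: "q \<in> X"
  using quasi_one_digit quasi_one_shift_le by (intro XI) auto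

lemma zero_in_X: "zero_digits \<in> X"
proof (rule XI)
  show "lex_le ((shift ^^ n) zero_digits) q" for n
    using zero_digits_le[of q] by (simp add: zero_digits_def shift_pow)
qed (simp add: zero_digits_def)

lemma zero_less_q: "less_fun zero_digits q"
  using quasi_one_0 by (intro less_funI exI[of _ 0]) (auto simp: zero_digits_def)

lemma shift_pow_X: "x \<in> X \<Longrightarrow> (shift ^^ n) x \<in> X"
  using X_digit[of x "_ + n"] X_shift_pow_le[of x "_ + n"] by (intro XI) (simp_all add: funpow_add)

lemma shift_X: "x \<in> X \<Longrightarrow> shift x \<in> X"
  using shift_pow_X[of x 1] by simp

lemma Q_subset: "p \<in> Q \<Longrightarrow> p \<in> X"
  by (simp add: Q_def)

lemma q_in_Q: "q \<in> Q"
  using q_in_X quasi_one_infinite_ones by (simp add: Q_def)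

lemma zero_less_Q: "p \<in> Q \<Longrightarrow> less_fun zero_digits p"
  using zero_digits_le[of p] by (auto simp: Q_def lex_le_def zero_digits_def)

lemma shift_Q: "p \<in> Q \<Longrightarrow> shift p \<in> Q"
proof -
  assume p: "p \<in> Q"
  have "\<exists>m\<ge>n. shift p m = 1" for n
  proof -
    obtain m where "m \<ge> Suc n" "p m = 1" using p unfolding Q_def by blast
    then show ?thesis by (intro exI[of _ "m - 1"]) (simp add: shift_def)
  qed
  then show ?thesis using p shift_X unfolding Q_def by blast
qed

text \<open>Since \<open>q\<close> begins with 1, a leading 0 is always admissible: the 0-branch of
  the inverse of the shift is full.\<close>

lemma cons0_X: "cons 0 x \<in> X \<longleftrightarrow> x \<in> X"
proof
  assume x: "x \<in> X"
  show "cons 0 x \<in> X"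
  proof (rule XI)
    show "cons 0 x i = 0 \<or> cons 0 x i = 1" for i using X_digit[OF x, of "i - 1"] by (cases i) auto
    show "lex_le ((shift ^^ n) (cons 0 x)) q" for n
    proof (cases n)
      case 0
      then show ?thesis using quasi_one_0 by (subst lex_le_iff_shift) simp
    next
      case (Suc k)
      then show ?thesis using X_shift_pow_le[OF x, of k] by (simp add: funpow_swap1)
    qed
  qed
qed (use shift_X[of "cons 0 x"] in simp)

text \<open>Both \<open>cons 1 x\<close> and \<open>q\<close> begin with 1, so comparing them
  amounts to comparing tails; the 1-branch is cut off at \<open>shift q\<close>.\<close>

lemma cons1_X: "cons 1 x \<in> X \<longleftrightarrow> x \<in> X \<and> lex_le x (shift q)"
proof
  assume x: "x \<in> X \<and> lex_le x (shift q)"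
  show "cons 1 x \<in> X"
  proof (rule XI)
    show "cons 1 x i = 0 \<or> cons 1 x i = 1" for i using X_digit[of x "i - 1"] x by (cases i) auto
    show "lex_le ((shift ^^ n) (cons 1 x)) q" for n
    proof (cases n)
      case 0
      then show ?thesis using quasi_one_0 x by (subst lex_le_iff_shift) simp
    next
      case (Suc k)
      then show ?thesis using X_shift_pow_le[of x k] x by (simp add: funpow_swap1)
    qed
  qed
next
  assume "cons 1 x \<in> X"
  then show "x \<in> X \<and> lex_le x (shift q)"
    using shift_X[of "cons 1 x"] X_le[of "cons 1 x"] quasi_one_0 lex_le_iff_shift[of "cons 1 x" q]
    by simp
qed

text \<open>Shifts by at most \<open>m\<close> drop strictly below the corresponding shifts of
  \<open>b\<close>; all later ones are shifts of \<open>y\<close>.\<close>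

lemma splice_zero_X:
  assumes b: "b \<in> X" "b m = 1" and y: "y \<in> X"
  shows "splice_zero m b y \<in> X"
proof (rule XI)
  show "splice_zero m b y i = 0 \<or> splice_zero m b y i = 1" for i
    using X_digit[OF b(1), of i] X_digit[OF y, of "i - Suc m"] by (simp add: splice_zero_def)
  show "lex_le ((shift ^^ n) (splice_zero m b y)) q" for n
  proof (cases "n \<le> m")
    case True
    have "less_fun ((shift ^^ n) (splice_zero m b y)) ((shift ^^ n) b)"
      using True b by (intro less_fun_shift_pow[of _ m]) (auto simp: splice_zero_def)
    then show ?thesis using X_shift_pow_le[OF b(1), of n] lex.less_le_trans lex.less_imp_le by blast
  next
    case False
    then show ?thesis using X_shift_pow_le[OF y] by (simp only: shift_pow_splice_zero not_le)
  qed
qed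

lemma splice_zero_Q:
  assumes "b \<in> X" "b m = 1" "y \<in> Q"
  shows "splice_zero m b y \<in> Q"
proof -
  have "\<exists>k\<ge>n. splice_zero m b y k = 1" for n
  proof -
    obtain k where "k \<ge> n" "y k = 1" using assms(3) by (auto simp: Q_def)
    then show ?thesis by (intro exI[of _ "k + Suc m"]) (auto simp: splice_zero_def)
  qed
  then show ?thesis using splice_zero_X assms by (auto simp: Q_def)
qed

text \<open>If \<open>q\<^sub>k = 1\<close> with \<open>k \<ge> 1\<close>, every sequence whose ones sit at multiples of \<open>k + 1\<close> is
  admissible.\<close>

lemma uncountable_X: "uncountable X"
proof -
  obtain k where k: "k \<ge> 1" "q k = 1" using quasi_one_infinite_ones by blast
  define g :: "nat set \<Rightarrow> digits" where
    "g S = (\<lambda>i. if Suc k dvd i \<and> i div Suc k \<in> S then 1 else 0)" for S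
  have "g S \<in> X" for S
  proof (rule XI)
    fix n
    show "lex_le ((shift ^^ n) (g S)) q"
    proof (cases "g S n = 0")
      case True
      then show ?thesis using quasi_one_0 by (subst lex_le_iff_shift) simp
    next
      case False
      then have n: "Suc k dvd n" by (auto simp: g_def split: if_splits)
      have z: "g S (j + n) = 0" if "1 \<le> j" "j \<le> k" for j
      proof -
        have "\<not> Suc k dvd j" using that by (auto dest: dvd_imp_le)
        then show ?thesis using n by (simp add: g_def dvd_add_left_iff)
      qed
      \<comment> \<open>\<open>m\<close> is the position of the second 1 of \<open>q\<close>. The
        shifted sequence and \<open>q\<close> both read 1 followed by zeros before \<open>m\<close>,
        and at \<open>m\<close>, which is at most \<open>k\<close>, the shifted sequence still has a
        0.\<close>
      define m where "m = (LEAST m. 1 \<le> m \<and> q m = 1)"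
      have m: "1 \<le> m" "q m = 1" "m \<le> k"
        using LeastI[of "\<lambda>m. 1 \<le> m \<and> q m = 1" k] Least_le[of "\<lambda>m. 1 \<le> m \<and> q m = 1" k] k
        by (auto simp: m_def)
      have "q j = g S (j + n)" if "j < m" for j
      proof (cases "j = 0")
        case True
        then show ?thesis using False quasi_one_0 by (auto simp: g_def split: if_splits)
      next
        case False
        then have "q j \<noteq> 1" using not_less_Least[of j "\<lambda>m. 1 \<le> m \<and> q m = 1"] that
          by (auto simp: m_def)
        then show ?thesis using quasi_one_digit[of j] z[of j] False that m by auto
      qed
      then have "less_fun ((shift ^^ n) (g S)) q"
        using m z[of m] by (intro less_funI exI[of _ m]) auto
      then show ?thesis by (rule lex.less_imp_le)
    qed
  qed (auto simp: g_def)
  moreover have "inj g"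
  proof (rule injI)
    fix S T assume "g S = g T"
    then have "g S (j * Suc k) = g T (j * Suc k)" for j by simp
    then have "(if j \<in> S then 1 else 0) = (if j \<in> T then 1 else (0::nat))" for j
      by (simp add: g_def del: mult_Suc_right)
    then have "j \<in> S \<longleftrightarrow> j \<in> T" for j by (metis zero_neq_one)
    then show "S = T" by blast
  qed
  ultimately have "countable X \<Longrightarrow> countable (UNIV :: nat set set)"
    by (metis (no_types, lifting) countable_image_inj_on countable_subset image_subsetI)
  then show ?thesis using uncountable_nat_sets by blast
qed

text \<open>\<open>p'\<close> has a 1 at some place \<open>m\<close> beyond the position where
  \<open>p\<close> is exceeded. Lowering this digit to 0 and appending an arbitrary point of
  \<open>X\<close> embeds \<open>X\<close> into the gap.\<close>

lemma uncountable_between: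
  assumes p: "less_fun p p'" and p': "p' \<in> Q"
  shows "uncountable {x \<in> X. less_fun p x \<and> less_fun x p'}"
proof -
  obtain k where k: "\<And>z. (\<And>i. i \<le> k \<Longrightarrow> z i = p' i) \<Longrightarrow> less_fun p z"
    using less_fun_prefix[OF p] by blast
  obtain m where m: "m \<ge> Suc k" "p' m = 1" using p' by (auto simp: Q_def)
  have "splice_zero m p' ` X \<subseteq> {x \<in> X. less_fun p x \<and> less_fun x p'}"
  proof safe
    fix y assume "y \<in> X"
    then show "splice_zero m p' y \<in> X" using splice_zero_X Q_subset p' m by blast
    show "less_fun p (splice_zero m p' y)" using m by (intro k) (auto simp: splice_zero_def)
    show "less_fun (splice_zero m p' y) p'" using m by (intro splice_zero_less)
  qed
  moreover have "uncountable (splice_zero m p' ` X)"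
    using uncountable_X splice_zero_inj by (metis countable_image_inj_on inj_onI)
  ultimately show ?thesis using countable_subset by blast
qed

text \<open>The supremum is built digit by digit: \<open>b n\<close> is 1 as soon as some member of
  \<open>D\<close> extends the digits chosen so far by a 1. Every prefix of \<open>b\<close> is then
  a prefix of a member of \<open>D\<close>, and since a violation of admissibility would show in a
  finite prefix, \<open>b\<close> is admissible.\<close>

lemma lex_supremum:
  assumes D: "D \<subseteq> X" "D \<noteq> {}"
  obtains b where "b \<in> X" "\<And>x. x \<in> D \<Longrightarrow> lex_le x b"
    "\<And>y. less_fun y b \<Longrightarrow> \<exists>x\<in>D. less_fun y x"
proof -
  \<comment> \<open>\<open>pre n\<close> carries the digits of \<open>b\<close> at places below
    \<open>n\<close> and 0 from there on.\<close>
  define pre :: "nat \<Rightarrow> digits" where "pre = rec_nat (\<lambda>_. 0)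
    (\<lambda>n g. g(n := if \<exists>x\<in>D. (\<forall>i<n. x i = g i) \<and> x n = 1 then 1 else 0))"
  have pre_Suc: "pre (Suc n) = (pre n)(n := if \<exists>x\<in>D. (\<forall>i<n. x i = pre n i) \<and> x n = 1 then 1 else 0)"
    for n by (simp add: pre_def)
  define b where "b n = pre (Suc n) n" for n
  have pre: "pre n i = b i" if "i < n" for i n
    using that
  proof (induction n)
    case (Suc n)
    then show ?case
    proof (cases "i = n")
      case False
      then have "pre (Suc n) i = pre n i" by (simp add: pre_Suc)
      then show ?thesis using Suc False by simp
    qed (simp add: b_def)
  qed simp
  have b: "b n = (if \<exists>x\<in>D. (\<forall>i<n. x i = b i) \<and> x n = 1 then 1 else 0)" for n
    using pre[of _ n] by (simp add: b_def[of n] pre_Suc)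
  have approx: "\<exists>x\<in>D. \<forall>i<n. x i = b i" for n
  proof (induction n)
    case (Suc n)
    then obtain x where x: "x \<in> D" "\<And>i. i < n \<Longrightarrow> x i = b i" by auto
    show ?case
    proof (cases "b n = 1")
      case True
      then have "\<exists>x\<in>D. (\<forall>i<n. x i = b i) \<and> x n = 1" using b[of n] by (metis zero_neq_one)
      then show ?thesis using True by (auto simp: less_Suc_eq)
    next
      case False
      then have "x n \<noteq> 1" "b n = 0" using b[of n] x by (auto split: if_splits)
      then have "x n = b n" using X_digit[of x n] x D by auto
      then show ?thesis using x by (auto simp: less_Suc_eq)
    qed
  qed (use D in auto)
  show ?thesis
  proof
    show "b \<in> X"
    proof (rule XI)
      show "b i = 0 \<or> b i = 1" for i using b[of i] by presburger
      fix n
      show "lex_le ((shift ^^ n) b) q"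
      proof (rule ccontr)
        assume "\<not> lex_le ((shift ^^ n) b) q"
        then have "less_fun q ((shift ^^ n) b)" by (simp add: lex.not_le)
        from less_fun_prefix[OF this] obtain k where
          k: "\<And>z. (\<And>i. i \<le> k \<Longrightarrow> z i = (shift ^^ n) b i) \<Longrightarrow> less_fun q z" by metis
        obtain x where x: "x \<in> D" "\<forall>i<Suc (k + n). x i = b i" using approx by blast
        then have "less_fun q ((shift ^^ n) x)" by (intro k) auto
        then show False using X_shift_pow_le[of x n] x D by (meson lex.not_le subsetD)
      qed
    qed
    show "lex_le x b" if x: "x \<in> D" for x
    proof (rule ccontr)
      assume "\<not> lex_le x b"
      then obtain k where k: "b k < x k" "\<forall>j<k. x j = b j"
        by (auto simp: lex.not_le elim!: less_funE)
      then have "x k = 1" using X_digit[of x k] x D by auto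
      then have "b k = 1" using k x by (subst b) auto
      then show False using \<open>x k = 1\<close> k by simp
    qed
    show "\<exists>x\<in>D. less_fun y x" if y: "less_fun y b" for y
    proof -
      obtain k where k: "\<And>z. (\<And>i. i \<le> k \<Longrightarrow> z i = b i) \<Longrightarrow> less_fun y z"
        using less_fun_prefix[OF y] by blast
      then show ?thesis using approx[of "Suc k"] by (meson less_Suc_eq_le)
    qed
  qed
qed

text \<open>A point of \<^term>\<open>X - Q\<close> other than 0 has the form \<open>w10\<^sup>\<infinity>\<close>; its immediate predecessor
  \<open>w0q\<close> lies in \<^term>\<open>Q\<close>.\<close>

lemma Q_predecessor:
  assumes b: "b \<in> X" "b \<notin> Q" "b \<noteq> zero_digits"
  obtains b' where "b' \<in> Q" "\<And>x. x \<in> X \<Longrightarrow> lex_le x b' \<longleftrightarrow> less_fun x b"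
proof -
  obtain n where n: "\<And>m. m \<ge> n \<Longrightarrow> b m \<noteq> 1" using b by (auto simp: Q_def)
  define M where "M = {m. b m = 1}"
  have "M \<subseteq> {..n}" using n nat_le_linear unfolding M_def by blast
  then have "finite M" by (rule finite_subset) simp
  moreover obtain j where "b j \<noteq> 0" using b(3) by (auto simp: zero_digits_def)
  then have "M \<noteq> {}" using X_digit[OF b(1), of j] by (auto simp: M_def)
  ultimately have "Max M \<in> M" "\<And>i. i \<in> M \<Longrightarrow> i \<le> Max M" by simp_all
  then obtain m where m: "b m = 1" "\<And>i. b i = 1 \<Longrightarrow> i \<le> m"
    unfolding M_def by blast
  have z: "b i = 0" if "i > m" for i using X_digit[OF b(1), of i] m(2)[of i] that by auto
  define b' where "b' = splice_zero m b q"
  have "b' \<in> Q" unfolding b'_def using splice_zero_Q b m q_in_Q by blast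
  moreover have "lex_le x b' \<longleftrightarrow> less_fun x b" if x: "x \<in> X" for x
  proof
    assume "lex_le x b'"
    then show "less_fun x b"
      using splice_zero_less[of b m q] m lex.le_less_trans unfolding b'_def by blast
  next
    assume "less_fun x b"
    then obtain k where k: "x k < b k" "\<And>j. j < k \<Longrightarrow> x j = b j" by (auto elim!: less_funE)
    then have "k \<le> m" using z by (metis not_less0 not_le)
    show "lex_le x b'"
    proof (cases "k = m")
      case True
      \<comment> \<open>Here \<open>x\<close> first differs from \<open>b\<close> at its last 1, so
        \<open>x\<close> begins like \<open>b'\<close>. The tail of \<open>b'\<close> is
        \<open>q\<close>, the largest tail that admissibility of \<open>x\<close> permits.\<close>
      have "x i = b' i" if "i < Suc m" for i
        using that k True m by (auto simp: b'_def splice_zero_def less_Suc_eq)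
      moreover have "lex_le ((shift ^^ Suc m) x) ((shift ^^ Suc m) b')"
        using X_shift_pow_le[OF x, of "Suc m"] unfolding b'_def
        by (subst shift_pow_splice_zero) simp_all
      ultimately show ?thesis using lex_le_prefix by blast
    next
      case False
      then have "less_fun x b'" using k \<open>k \<le> m\<close>
        by (intro less_funI exI[of _ k]) (auto simp: b'_def splice_zero_def)
      then show ?thesis by (rule lex.less_imp_le)
    qed
  qed
  ultimately show ?thesis using that by blast
qed

text \<open>Up to its supremum \<open>b\<close> itself, \<open>D\<close> consists of the points
  below \<open>b\<close>. If \<open>b\<close> is not in \<open>Q\<close>, its predecessor describes
  the same set; the exception \<open>b = zero_digits\<close> leaves at most one point. The set in
  the second alternative is the symmetric difference of \<open>D\<close> and the points up to
  \<open>b\<close>.\<close>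

lemma lower_set_eq:
  assumes D: "D \<subseteq> X" "\<And>x y. x \<in> D \<Longrightarrow> y \<in> X \<Longrightarrow> less_fun y x \<Longrightarrow> y \<in> D"
  obtains "countable D"
  | b where "b \<in> Q" "countable {x \<in> X. x \<in> D \<longleftrightarrow> \<not> lex_le x b}"
proof (cases "D = {}")
  case False
  from lex_supremum[OF D(1) False] obtain b where b: "b \<in> X" "\<And>x. x \<in> D \<Longrightarrow> lex_le x b"
    "\<And>y. less_fun y b \<Longrightarrow> \<exists>x\<in>D. less_fun y x" by metis
  have less: "y \<in> D" if "y \<in> X" "less_fun y b" for y using b(3) D(2) that by blast
  show ?thesis
  proof (cases "b = zero_digits")
    case True
    have "D \<subseteq> {zero_digits}" using b True zero_digits_le lex.order_antisym by blast
    then have "countable D" by (meson countable_finite finite.emptyI finite.insertI countable_subset)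
    then show ?thesis by (rule that)
  next
    case nz: False
    have "\<exists>b'\<in>Q. \<forall>x\<in>X. x \<noteq> b \<longrightarrow> (lex_le x b' \<longleftrightarrow> less_fun x b)"
    proof (cases "b \<in> Q")
      case True
      then show ?thesis by (auto simp: lex_le_def)
    next
      case False
      then show ?thesis using Q_predecessor[OF b(1) False nz] by metis
    qed
    then obtain b' where b': "b' \<in> Q" "\<And>x. x \<in> X \<Longrightarrow> x \<noteq> b \<Longrightarrow> lex_le x b' \<longleftrightarrow> less_fun x b" by blast
    have "{x \<in> X. x \<in> D \<longleftrightarrow> \<not> lex_le x b'} \<subseteq> {b}"
      using b' b(2) less by (auto simp: lex_le_def)
    then have "countable {x \<in> X. x \<in> D \<longleftrightarrow> \<not> lex_le x b'}"
      by (meson countable_finite finite.emptyI finite.insertI countable_subset)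
    then show ?thesis using that b' by blast
  qed
qed (use that in simp)

end

section \<open>Absolutely summable families\<close>

definition l1 :: "('i \<Rightarrow> complex) set" where
  "l1 = {a. (\<lambda>p. cmod (a p)) summable_on UNIV}"

definition l1norm :: "('i \<Rightarrow> complex) \<Rightarrow> real" where
  "l1norm a = infsum (\<lambda>p. cmod (a p)) UNIV"

lemma l1norm_nonneg: "0 \<le> l1norm a"
  unfolding l1norm_def by (rule infsum_nonneg) simp

lemma l1_bounded_sums:
  assumes "\<And>S. finite S \<Longrightarrow> (\<Sum>p\<in>S. cmod (a p)) \<le> M"
  shows "a \<in> l1" "l1norm a \<le> M"
proof -
  have "bdd_above (sum (\<lambda>p. cmod (a p)) ` {F. F \<subseteq> UNIV \<and> finite F})"
    using assms by (intro bdd_aboveI[of _ M]) auto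
  then have s: "(\<lambda>p. cmod (a p)) summable_on UNIV"
    by (intro nonneg_bdd_above_summable_on) auto
  then show "a \<in> l1" by (simp add: l1_def)
  show "l1norm a \<le> M" unfolding l1norm_def using s assms by (intro infsum_le_finite_sums) auto
qed

lemma sum_le_l1norm: "a \<in> l1 \<Longrightarrow> finite S \<Longrightarrow> (\<Sum>p\<in>S. cmod (a p)) \<le> l1norm a"
  unfolding l1_def l1norm_def by (intro finite_sum_le_infsum) auto

lemma cmod_le_l1norm: "a \<in> l1 \<Longrightarrow> cmod (a p) \<le> l1norm a"
  using sum_le_l1norm[of a "{p}"] by simp

lemma l1_summable_on: "a \<in> l1 \<Longrightarrow> a summable_on S"
  unfolding l1_def using abs_summable_summable summable_on_subset_banach by blast

lemma l1_cmod_summable_on: "a \<in> l1 \<Longrightarrow> (\<lambda>p. cmod (a p)) summable_on S"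
  unfolding l1_def using summable_on_subset_banach by blast

lemma cmod_infsum_le: "a \<in> l1 \<Longrightarrow> cmod (infsum a S) \<le> infsum (\<lambda>p. cmod (a p)) S"
  using l1_cmod_summable_on by (intro norm_infsum_bound) 

lemma cmod_infsum_le_l1norm: "a \<in> l1 \<Longrightarrow> cmod (infsum a S) \<le> l1norm a"
proof -
  assume a: "a \<in> l1"
  have "infsum (\<lambda>p. cmod (a p)) S \<le> l1norm a"
    unfolding l1norm_def using l1_cmod_summable_on[OF a] by (intro infsum_mono2) auto
  then show ?thesis using cmod_infsum_le[OF a, of S] by linarith
qed

lemma l1_diff:
  assumes "a \<in> l1" "b \<in> l1"
  shows "(\<lambda>p. a p - b p) \<in> l1" "l1norm (\<lambda>p. a p - b p) \<le> l1norm a + l1norm b"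
proof -
  have *: "(\<Sum>p\<in>S. cmod (a p - b p)) \<le> l1norm a + l1norm b" if "finite S" for S
  proof -
    have "(\<Sum>p\<in>S. cmod (a p - b p)) \<le> (\<Sum>p\<in>S. cmod (a p) + cmod (b p))"
      by (intro sum_mono norm_triangle_ineq4)
    then show ?thesis using sum_le_l1norm[OF assms(1) that] sum_le_l1norm[OF assms(2) that]
      by (simp add: sum.distrib)
  qed
  show "(\<lambda>p. a p - b p) \<in> l1" "l1norm (\<lambda>p. a p - b p) \<le> l1norm a + l1norm b"
    using l1_bounded_sums[OF *] by blast+
qed

lemma l1_scale:
  assumes "a \<in> l1"
  shows "(\<lambda>p. c * a p) \<in> l1" "l1norm (\<lambda>p. c * a p) = cmod c * l1norm a"
  using assms unfolding l1_def l1norm_def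
  by (auto simp: norm_mult infsum_cmult_right intro: summable_on_cmult_right)

lemma l1_add:
  assumes "a \<in> l1" "b \<in> l1"
  shows "(\<lambda>p. a p + b p) \<in> l1" "l1norm (\<lambda>p. a p + b p) \<le> l1norm a + l1norm b"
  using l1_diff[OF assms(1) l1_scale(1)[OF assms(2), of "-1"]] l1_scale(2)[OF assms(2), of "-1"]
  by simp_all

lemma l1norm_minus_commute: "l1norm (\<lambda>p. a p - b p) = l1norm (\<lambda>p. b p - a p)"
  unfolding l1norm_def by (simp add: norm_minus_commute)

lemma l1norm_0 [simp]: "l1norm (\<lambda>p. 0) = 0"
  by (simp add: l1norm_def)

lemma zero_in_l1 [simp]: "(\<lambda>p. 0) \<in> l1"
  by (simp add: l1_def)

lemma l1_finite_support:
  assumes "finite S" "\<And>p. p \<notin> S \<Longrightarrow> a p = 0"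
  shows "a \<in> l1" "infsum a T = (\<Sum>p\<in>S \<inter> T. a p)" "l1norm a = (\<Sum>p\<in>S. cmod (a p))"
proof -
  have "(\<lambda>p. cmod (a p)) summable_on UNIV \<longleftrightarrow> (\<lambda>p. cmod (a p)) summable_on S"
    using assms by (intro summable_on_cong_neutral) auto
  then show "a \<in> l1" using assms by (simp add: l1_def)
  have "infsum a T = infsum a (S \<inter> T)" using assms by (intro infsum_cong_neutral) auto
  then show "infsum a T = (\<Sum>p\<in>S \<inter> T. a p)" using assms by simp
  have "infsum (\<lambda>p. cmod (a p)) UNIV = infsum (\<lambda>p. cmod (a p)) S"
    using assms by (intro infsum_cong_neutral) auto
  then show "l1norm a = (\<Sum>p\<in>S. cmod (a p))" using assms by (simp add: l1norm_def)
qed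

lemma l1_truncate:
  assumes a: "a \<in> l1" and e: "0 < e"
  obtains S where "finite S" "l1norm (\<lambda>p. a p - (if p \<in> S then a p else 0)) < e"
proof -
  have "(\<lambda>p. cmod (a p)) summable_on UNIV" using a by (simp add: l1_def)
  then obtain S where S: "finite S" "dist (sum (\<lambda>p. cmod (a p)) S) (l1norm a) \<le> e / 2"
    unfolding l1norm_def using infsum_finite_approximation[of "\<lambda>p. cmod (a p)" UNIV "e / 2"] e by auto
  define b where "b = (\<lambda>p. a p - (if p \<in> S then a p else 0))"
  have "(\<Sum>p\<in>T. cmod (b p)) \<le> e / 2" if "finite T" for T
  proof -
    have "(\<Sum>p\<in>T. cmod (b p)) = (\<Sum>p\<in>T - S. cmod (a p))"
      using that by (intro sum.mono_neutral_cong_right) (auto simp: b_def)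
    moreover have "(\<Sum>p\<in>S. cmod (a p)) + (\<Sum>p\<in>T - S. cmod (a p)) = (\<Sum>p\<in>S \<union> (T - S). cmod (a p))"
      using S that by (intro sum.union_disjoint[symmetric]) auto
    moreover have "\<dots> \<le> l1norm a"
      using a S that by (intro sum_le_l1norm) auto
    ultimately show ?thesis using S(2) unfolding dist_real_def by linarith
  qed
  from l1_bounded_sums(2)[OF this] have "l1norm b < e" using e by simp
  then show ?thesis using that S(1) unfolding b_def by blast
qed

text \<open>The limit is formed pointwise, and bounds on finite sums survive the limit in one index.
  Norm convergence serves to identify \<open>F_space\<close>, pointwise convergence to pass through
  \<open>wop\<close> and to keep the support in \<open>Q\<close>.\<close>

lemma l1_complete:
  assumes A: "\<And>n. A n \<in> l1"
    and C: "\<And>e. e > 0 \<Longrightarrow> \<exists>N. \<forall>m\<ge>N. \<forall>n\<ge>N. l1norm (\<lambda>p. A m p - A n p) < e"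
  obtains a where "a \<in> l1" "(\<lambda>n. l1norm (\<lambda>p. A n p - a p)) \<longlonglongrightarrow> 0"
    "\<And>p. (\<lambda>n. A n p) \<longlonglongrightarrow> a p"
proof -
  have "Cauchy (\<lambda>n. A n p)" for p
  proof (rule CauchyI)
    fix e :: real assume "e > 0"
    then obtain N where "\<forall>m\<ge>N. \<forall>n\<ge>N. l1norm (\<lambda>p. A m p - A n p) < e" using C by blast
    then show "\<exists>N. \<forall>m\<ge>N. \<forall>n\<ge>N. norm (A m p - A n p) < e"
      using cmod_le_l1norm[OF l1_diff(1)[OF A A]] by (meson le_less_trans)
  qed
  then have "\<exists>l. (\<lambda>n. A n p) \<longlonglongrightarrow> l" for p
    using Cauchy_convergent_iff convergent_def by blast
  then obtain a where a: "\<And>p. (\<lambda>n. A n p) \<longlonglongrightarrow> a p" by metis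
  have bound: "\<exists>N. \<forall>n\<ge>N. (\<lambda>p. A n p - a p) \<in> l1 \<and> l1norm (\<lambda>p. A n p - a p) \<le> e" if "e > 0" for e
  proof -
    from that obtain N where N: "\<forall>m\<ge>N. \<forall>n\<ge>N. l1norm (\<lambda>p. A m p - A n p) < e" using C by blast
    have "(\<Sum>p\<in>S. cmod (A n p - a p)) \<le> e" if "n \<ge> N" "finite S" for n S
    proof (rule tendsto_upperbound)
      show "(\<lambda>m. \<Sum>p\<in>S. cmod (A n p - A m p)) \<longlonglongrightarrow> (\<Sum>p\<in>S. cmod (A n p - a p))"
        by (intro tendsto_intros a)
      show "eventually (\<lambda>m. (\<Sum>p\<in>S. cmod (A n p - A m p)) \<le> e) sequentially"
        unfolding eventually_sequentially
      proof (intro exI[of _ N] allI impI)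
        fix m assume "m \<ge> N"
        have "(\<Sum>p\<in>S. cmod (A n p - A m p)) \<le> l1norm (\<lambda>p. A n p - A m p)"
          using l1_diff(1)[OF A A] \<open>finite S\<close> by (intro sum_le_l1norm)
        then show "(\<Sum>p\<in>S. cmod (A n p - A m p)) \<le> e"
          using N \<open>m \<ge> N\<close> \<open>n \<ge> N\<close> by (meson le_less_trans less_imp_le)
      qed
    qed simp
    then have "(\<lambda>p. A n p - a p) \<in> l1 \<and> l1norm (\<lambda>p. A n p - a p) \<le> e" if "n \<ge> N" for n
      using that by (intro conjI l1_bounded_sums[of "\<lambda>p. A n p - a p" e]) auto
    then show ?thesis by blast
  qed
  obtain N where "(\<lambda>p. A N p - a p) \<in> l1" using bound[of 1] by auto
  from l1_diff(1)[OF A this, of N] have "a \<in> l1" by simp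
  moreover have "(\<lambda>n. l1norm (\<lambda>p. A n p - a p)) \<longlonglongrightarrow> 0"
  proof (rule LIMSEQ_I)
    fix e :: real assume "e > 0"
    then obtain N where "\<forall>n\<ge>N. l1norm (\<lambda>p. A n p - a p) \<le> e / 2" using bound[of "e / 2"] by auto
    then show "\<exists>N. \<forall>n\<ge>N. norm (l1norm (\<lambda>p. A n p - a p) - 0) < e"
      using l1norm_nonneg \<open>e > 0\<close>
      by (intro exI[of _ N]) (auto simp: l1norm_nonneg intro: le_less_trans[where y = "e / 2"])
  qed
  ultimately show ?thesis using that a by blast
qed

section \<open>Functions of bounded variation\<close>

text \<open>Separates agreement modulo countable sets from the membership in \<open>BV\<close> that
  \<open>BV_rel\<close> demands as well; \<open>BV_rel_iff\<close> joins the two.\<close>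

definition co_eq :: "real \<Rightarrow> (digits \<Rightarrow> complex) \<Rightarrow> (digits \<Rightarrow> complex) \<Rightarrow> bool" where
  "co_eq \<beta> f g \<longleftrightarrow> countable {x \<in> beta_shift \<beta>. f x \<noteq> g x}"

lemma co_eq_refl [simp]: "co_eq \<beta> f f"
  by (simp add: co_eq_def)

lemma co_eq_sym: "co_eq \<beta> f g \<Longrightarrow> co_eq \<beta> g f"
  by (simp add: co_eq_def eq_commute)

lemma co_eq_map2:
  assumes "co_eq \<beta> f f'" "co_eq \<beta> g g'"
    and "\<And>x. f x = f' x \<Longrightarrow> g x = g' x \<Longrightarrow> h x = h' x"
  shows "co_eq \<beta> h h'"
proof -
  have "{x \<in> beta_shift \<beta>. h x \<noteq> h' x}
      \<subseteq> {x \<in> beta_shift \<beta>. f x \<noteq> f' x} \<union> {x \<in> beta_shift \<beta>. g x \<noteq> g' x}"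
    using assms(3) by blast
  then show ?thesis
    using assms(1,2) countable_Un countable_subset unfolding co_eq_def by blast
qed

lemma co_eq_trans: "co_eq \<beta> f g \<Longrightarrow> co_eq \<beta> g h \<Longrightarrow> co_eq \<beta> f h"
  by (rule co_eq_map2[of \<beta> f g g h]) simp_all

lemma co_eq_diff:
  assumes "co_eq \<beta> f f'" "co_eq \<beta> g g'"
  shows "co_eq \<beta> (\<lambda>x. f x - g x) (\<lambda>x. f' x - g' x)"
  using assms by (rule co_eq_map2) simp

lemma co_eq_scale: "co_eq \<beta> f g \<Longrightarrow> co_eq \<beta> (\<lambda>x. c * f x) (\<lambda>x. c * g x)"
  by (rule co_eq_map2[of \<beta> f g f g]) simp_all

section \<open>Variation along chains and the quotient norm\<close>

context beta_expansion
begin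

abbreviation chain_sum :: "(digits \<Rightarrow> complex) \<Rightarrow> nat \<Rightarrow> (nat \<Rightarrow> digits) \<Rightarrow> real" where
  "chain_sum f n c \<equiv> \<Sum>i<n. cmod (f (c (Suc i)) - f (c i))"

text \<open>Variation sums admit only chains from \<open>zero_digits\<close> to \<open>q\<close>, so
  interior points are completed by both ends. This shifts their index by one.\<close>

lemma full_chain_extend:
  assumes "\<And>i. i < m \<Longrightarrow> z i \<in> X" "\<And>i. Suc i < m \<Longrightarrow> less_fun (z i) (z (Suc i))"
    "\<And>i. i < m \<Longrightarrow> z i \<noteq> zero_digits" "\<And>i. i < m \<Longrightarrow> z i \<noteq> q"
  shows "full_chain \<beta> (Suc m) (\<lambda>i. if i = 0 then zero_digits else if i \<le> m then z (i - 1) else q)"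
    (is "full_chain \<beta> _ ?c")
  unfolding full_chain_def
proof (intro conjI allI impI)
  fix i assume "i < Suc m"
  show "less_fun (?c i) (?c (Suc i))"
  proof (cases "i = 0")
    case True
    then show ?thesis using assms(3)[of 0] zero_digits_le[of "z 0"] zero_less_q by (auto simp: lex_le_def)
  next
    case False
    then obtain j where j: "i = Suc j" using not0_implies_Suc by blast
    show ?thesis
    proof (cases "i < m")
      case True
      then show ?thesis using assms(2)[of j] j by simp
    next
      case False
      then have "Suc j = m" using \<open>i < Suc m\<close> j by simp
      then show ?thesis using j assms(1)[of j] assms(4)[of j] X_le[of "z j"] by (auto simp: lex_le_def)
    qed
  qed
qed (use assms zero_in_X q_in_X in auto)

text \<open>Makes the set of variation sums nonempty, as its real \<open>Sup\<close>
  requires.\<close>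

lemma full_chain_exists: "full_chain \<beta> 1 (\<lambda>i. if i = 0 then zero_digits else q)"
  using zero_less_q zero_in_X q_in_X by (auto simp: full_chain_def)

lemma chain_sum_le_variation:
  "f \<in> BV \<beta> \<Longrightarrow> full_chain \<beta> n c \<Longrightarrow> chain_sum f n c \<le> variation \<beta> f"
  unfolding BV_def variation_def by (intro cSup_upper) (auto simp: variation_sums_def)

lemma variation_le:
  assumes "\<And>n c. full_chain \<beta> n c \<Longrightarrow> chain_sum f n c \<le> M"
  shows "bdd_above (variation_sums \<beta> f)" "variation \<beta> f \<le> M"
proof -
  show "bdd_above (variation_sums \<beta> f)"
    using assms by (intro bdd_aboveI[of _ M]) (auto simp: variation_sums_def)
  have "variation_sums \<beta> f \<noteq> {}" using full_chain_exists by (auto simp: variation_sums_def)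
  then show "variation \<beta> f \<le> M"
    unfolding variation_def using assms by (intro cSup_least) (auto simp: variation_sums_def)
qed

lemma variation_nonneg: "f \<in> BV \<beta> \<Longrightarrow> 0 \<le> variation \<beta> f"
  by (rule order_trans[OF _ chain_sum_le_variation[OF _ full_chain_exists]]) (auto intro: sum_nonneg)

lemma BV_outside: "f \<in> BV \<beta> \<Longrightarrow> x \<notin> X \<Longrightarrow> f x = 0"
  by (simp add: BV_def)

text \<open>Inserting \<open>x\<close> into the chain from \<open>zero_digits\<close> to
  \<open>q\<close> bounds its distance from the value at \<open>zero_digits\<close>. Boundedness is
  what makes \<open>sup_norm\<close> a genuine supremum.\<close>

lemma BV_bounded:
  assumes f: "f \<in> BV \<beta>" and x: "x \<in> X"
  shows "cmod (f x) \<le> cmod (f zero_digits) + variation \<beta> f"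
proof -
  have tri: "cmod (f x) \<le> cmod (f zero_digits) + cmod (f x - f zero_digits)"
    using norm_triangle_sub by blast
  consider "x = zero_digits" | "x = q" | "x \<noteq> zero_digits" "x \<noteq> q" by blast
  then have "cmod (f x - f zero_digits) \<le> variation \<beta> f"
  proof cases
    case 1
    then show ?thesis using variation_nonneg[OF f] by simp
  next
    case 2
    then show ?thesis using chain_sum_le_variation[OF f full_chain_exists] by simp
  next
    case 3
    have "full_chain \<beta> 2 (\<lambda>i. if i = 0 then zero_digits else if i \<le> 1 then x else q)"
      using full_chain_extend[of 1 "\<lambda>_. x"] 3 x by (simp add: numeral_2_eq_2)
    from chain_sum_le_variation[OF f this]
    have "cmod (f x - f zero_digits) + cmod (f q - f x) \<le> variation \<beta> f"
      by (simp add: numeral_2_eq_2)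
    then show ?thesis using norm_ge_zero[of "f q - f x"] by linarith
  qed
  then show ?thesis using tri by linarith
qed

lemma BV_bdd_above: "f \<in> BV \<beta> \<Longrightarrow> bdd_above ((\<lambda>x. cmod (f x)) ` X)"
  using BV_bounded by (intro bdd_aboveI2)

lemma cmod_le_sup_norm: "f \<in> BV \<beta> \<Longrightarrow> x \<in> X \<Longrightarrow> cmod (f x) \<le> sup_norm \<beta> f"
  unfolding sup_norm_def using BV_bdd_above by (intro cSUP_upper)

lemma sup_norm_le: "(\<And>x. x \<in> X \<Longrightarrow> cmod (f x) \<le> M) \<Longrightarrow> sup_norm \<beta> f \<le> M"
  unfolding sup_norm_def using zero_in_X by (intro cSUP_least) auto

lemma sup_norm_nonneg: "f \<in> BV \<beta> \<Longrightarrow> 0 \<le> sup_norm \<beta> f"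
  using cmod_le_sup_norm[OF _ zero_in_X] norm_ge_zero order_trans by blast

lemma bv_norm_nonneg: "f \<in> BV \<beta> \<Longrightarrow> 0 \<le> bv_norm \<beta> f"
  unfolding bv_norm_def using sup_norm_nonneg variation_nonneg by (intro add_nonneg_nonneg)

lemma BV_diff:
  assumes f: "f \<in> BV \<beta>" and g: "g \<in> BV \<beta>"
  shows "(\<lambda>x. f x - g x) \<in> BV \<beta>"
    and "bv_norm \<beta> (\<lambda>x. f x - g x) \<le> bv_norm \<beta> f + bv_norm \<beta> g"
proof -
  have *: "chain_sum (\<lambda>x. f x - g x) n c \<le> variation \<beta> f + variation \<beta> g" if "full_chain \<beta> n c" for n c
  proof -
    have "chain_sum (\<lambda>x. f x - g x) n c \<le>
        (\<Sum>i<n. cmod (f (c (Suc i)) - f (c i)) + cmod (g (c (Suc i)) - g (c i)))"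
    proof (rule sum_mono)
      fix i
      show "cmod (f (c (Suc i)) - g (c (Suc i)) - (f (c i) - g (c i)))
          \<le> cmod (f (c (Suc i)) - f (c i)) + cmod (g (c (Suc i)) - g (c i))"
        using norm_triangle_ineq4[of "f (c (Suc i)) - f (c i)" "g (c (Suc i)) - g (c i)"]
        by (simp add: algebra_simps)
    qed
    then show ?thesis using chain_sum_le_variation[OF f that] chain_sum_le_variation[OF g that]
      by (simp add: sum.distrib)
  qed
  show "(\<lambda>x. f x - g x) \<in> BV \<beta>"
    using variation_le(1)[of "\<lambda>x. f x - g x", OF *] f g by (simp add: BV_def)
  have "sup_norm \<beta> (\<lambda>x. f x - g x) \<le> sup_norm \<beta> f + sup_norm \<beta> g"
  proof (rule sup_norm_le)
    fix x assume "x \<in> X"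
    then show "cmod (f x - g x) \<le> sup_norm \<beta> f + sup_norm \<beta> g"
      using norm_triangle_ineq4[of "f x" "g x"] cmod_le_sup_norm[OF f] cmod_le_sup_norm[OF g]
      by (meson add_mono order_trans)
  qed
  then show "bv_norm \<beta> (\<lambda>x. f x - g x) \<le> bv_norm \<beta> f + bv_norm \<beta> g"
    using variation_le(2)[of "\<lambda>x. f x - g x", OF *] by (simp add: bv_norm_def)
qed

lemma BV_rel_iff: "(f, g) \<in> BV_rel \<beta> \<longleftrightarrow> f \<in> BV \<beta> \<and> g \<in> BV \<beta> \<and> co_eq \<beta> f g"
  using BV_diff(1) by (auto simp: BV_rel_def BV_null_def co_eq_def)

lemma cls_iff: "g \<in> cls \<beta> f \<longleftrightarrow> f \<in> BV \<beta> \<and> g \<in> BV \<beta> \<and> co_eq \<beta> f g"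
  by (auto simp: cls_def BV_rel_iff)

lemma cls_eq_iff:
  assumes "f \<in> BV \<beta>" "g \<in> BV \<beta>"
  shows "cls \<beta> f = cls \<beta> g \<longleftrightarrow> co_eq \<beta> f g"
proof
  assume "cls \<beta> f = cls \<beta> g"
  then have "g \<in> cls \<beta> f" using assms by (simp add: cls_iff)
  then show "co_eq \<beta> f g" by (simp add: cls_iff)
next
  assume "co_eq \<beta> f g"
  then have "co_eq \<beta> f h \<longleftrightarrow> co_eq \<beta> g h" for h using co_eq_sym co_eq_trans by metis
  then show "cls \<beta> f = cls \<beta> g" using assms by (simp add: set_eq_iff cls_iff)
qed

text \<open>Differences, multiples and the transfer operator are all defined on classes as unions
  over representatives. Compatibility with \<open>co_eq\<close> collapses such a union to a single
  class.\<close>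

lemma cls_image:
  assumes f: "f \<in> BV \<beta>" and c: "\<And>g. g \<in> BV \<beta> \<Longrightarrow> co_eq \<beta> f g \<Longrightarrow> co_eq \<beta> (F f) (F g)"
    and F: "F f \<in> BV \<beta>"
  shows "(\<Union>g\<in>cls \<beta> f. cls \<beta> (F g)) = cls \<beta> (F f)"
proof (intro set_eqI iffI)
  fix k assume "k \<in> (\<Union>g\<in>cls \<beta> f. cls \<beta> (F g))"
  then show "k \<in> cls \<beta> (F f)" using c[THEN co_eq_trans] F by (auto simp: cls_iff)
next
  fix k assume "k \<in> cls \<beta> (F f)"
  moreover have "f \<in> cls \<beta> f" using f by (simp add: cls_iff)
  ultimately show "k \<in> (\<Union>g\<in>cls \<beta> f. cls \<beta> (F g))" by blast
qed

lemma scale_cls_eq: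
  assumes "f \<in> BV \<beta>" "(\<lambda>x. c * f x) \<in> BV \<beta>"
  shows "scale_cls \<beta> c (cls \<beta> f) = cls \<beta> (\<lambda>x. c * f x)"
  unfolding scale_cls_def using assms
  by (intro cls_image[of f "\<lambda>f x. c * f x"]) (auto intro: co_eq_scale)

lemma diff_cls_eq:
  assumes f: "f \<in> BV \<beta>" and g: "g \<in> BV \<beta>"
  shows "diff_cls \<beta> (cls \<beta> f) (cls \<beta> g) = cls \<beta> (\<lambda>x. f x - g x)"
proof -
  have "(\<Union>g'\<in>cls \<beta> g. cls \<beta> (\<lambda>x. f' x - g' x)) = cls \<beta> (\<lambda>x. f' x - g x)" if "f' \<in> BV \<beta>" for f'
    using g that BV_diff(1)
    by (intro cls_image[of g "\<lambda>g x. f' x - g x"]) (auto intro: co_eq_diff)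
  then have "diff_cls \<beta> (cls \<beta> f) (cls \<beta> g) = (\<Union>f'\<in>cls \<beta> f. cls \<beta> (\<lambda>x. f' x - g x))"
    unfolding diff_cls_def by (intro SUP_cong) (auto simp: cls_iff)
  also have "\<dots> = cls \<beta> (\<lambda>x. f x - g x)"
    using f g BV_diff(1)
    by (intro cls_image[of f "\<lambda>f x. f x - g x"]) (auto intro: co_eq_diff)
  finally show ?thesis .
qed

lemma quot_norm_cls: "f \<in> BV \<beta> \<Longrightarrow> quot_norm \<beta> (cls \<beta> f) = (INF g\<in>{g \<in> BV \<beta>. co_eq \<beta> f g}. bv_norm \<beta> g)"
  unfolding quot_norm_def by (intro arg_cong[of _ _ Inf] image_cong) (auto simp: cls_iff)

lemma bv_norm_bdd_below: "bdd_below (bv_norm \<beta> ` {g \<in> BV \<beta>. co_eq \<beta> f g})"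
  using bv_norm_nonneg by (intro bdd_belowI2[of _ 0]) auto

lemma quot_norm_le:
  assumes "f \<in> BV \<beta>" "g \<in> BV \<beta>" "co_eq \<beta> f g"
  shows "quot_norm \<beta> (cls \<beta> f) \<le> bv_norm \<beta> g"
  unfolding quot_norm_cls[OF assms(1)] using assms bv_norm_bdd_below by (intro cINF_lower) auto

lemma quot_norm_ge:
  assumes "f \<in> BV \<beta>" "\<And>g. g \<in> BV \<beta> \<Longrightarrow> co_eq \<beta> f g \<Longrightarrow> M \<le> bv_norm \<beta> g"
  shows "M \<le> quot_norm \<beta> (cls \<beta> f)"
  unfolding quot_norm_cls[OF assms(1)] using assms co_eq_refl by (intro cINF_greatest) auto

lemma quot_norm_less:
  assumes "f \<in> BV \<beta>" "quot_norm \<beta> (cls \<beta> f) < M"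
  obtains g where "g \<in> BV \<beta>" "co_eq \<beta> f g" "bv_norm \<beta> g < M"
  using assms quot_norm_ge by (meson not_le)

lemma quot_norm_diff:
  assumes f: "f \<in> BV \<beta>" and g: "g \<in> BV \<beta>"
  shows "quot_norm \<beta> (cls \<beta> (\<lambda>x. f x - g x)) \<le> quot_norm \<beta> (cls \<beta> f) + quot_norm \<beta> (cls \<beta> g)"
proof (rule field_le_epsilon)
  fix e :: real assume e: "0 < e"
  obtain f' where f': "f' \<in> BV \<beta>" "co_eq \<beta> f f'" "bv_norm \<beta> f' < quot_norm \<beta> (cls \<beta> f) + e / 2"
    using quot_norm_less[OF f, of "quot_norm \<beta> (cls \<beta> f) + e / 2"] e by auto
  obtain g' where g': "g' \<in> BV \<beta>" "co_eq \<beta> g g'" "bv_norm \<beta> g' < quot_norm \<beta> (cls \<beta> g) + e / 2"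
    using quot_norm_less[OF g, of "quot_norm \<beta> (cls \<beta> g) + e / 2"] e by auto
  have "quot_norm \<beta> (cls \<beta> (\<lambda>x. f x - g x)) \<le> bv_norm \<beta> (\<lambda>x. f' x - g' x)"
    using f g f' g' BV_diff(1) by (intro quot_norm_le co_eq_diff)
  also have "\<dots> \<le> bv_norm \<beta> f' + bv_norm \<beta> g'" using f' g' BV_diff(2) by blast
  finally show "quot_norm \<beta> (cls \<beta> (\<lambda>x. f x - g x)) \<le> quot_norm \<beta> (cls \<beta> f) + quot_norm \<beta> (cls \<beta> g) + e"
    using f' g' by linarith
qed

text \<open>Representatives of norm below \<open>1 / Suc n\<close> each differ from \<open>f\<close>
  on a countable set only. Off the union of these sets \<open>f\<close> is smaller than every
  \<open>1 / Suc n\<close>.\<close>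

lemma quot_norm_eq_0:
  assumes f: "f \<in> BV \<beta>" and "\<And>e. e > 0 \<Longrightarrow> quot_norm \<beta> (cls \<beta> f) < e"
  shows "co_eq \<beta> f (\<lambda>_. 0)"
proof -
  have "\<exists>g. g \<in> BV \<beta> \<and> co_eq \<beta> f g \<and> bv_norm \<beta> g < 1 / Suc n" for n
    using quot_norm_less[OF f assms(2)[of "1 / Suc n"]] by (metis of_nat_0_less_iff zero_less_Suc zero_less_divide_1_iff)
  then obtain g where g: "\<And>n. g n \<in> BV \<beta>" "\<And>n. co_eq \<beta> f (g n)" "\<And>n. bv_norm \<beta> (g n) < 1 / Suc n"
    by metis
  have "{x \<in> X. f x \<noteq> 0} \<subseteq> (\<Union>n. {x \<in> X. f x \<noteq> g n x})"
  proof (intro subsetI, rule ccontr)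
    fix x assume x: "x \<in> {x \<in> X. f x \<noteq> 0}" "x \<notin> (\<Union>n. {x \<in> X. f x \<noteq> g n x})"
    have "cmod (f x) < 1 / Suc n" for n
    proof -
      have "cmod (g n x) \<le> sup_norm \<beta> (g n)" using cmod_le_sup_norm[OF g(1)] x by blast
      then have "cmod (g n x) < 1 / Suc n"
        using g(3)[of n] variation_nonneg[OF g(1), of n] unfolding bv_norm_def by linarith
      then show ?thesis using x by auto
    qed
    moreover obtain n where "inverse (real (Suc n)) < cmod (f x)"
      using reals_Archimedean[of "cmod (f x)"] x by auto
    ultimately show False by (metis inverse_eq_divide less_asym)
  qed
  then show ?thesis using g(2) unfolding co_eq_def
    by (meson countable_UN countable_subset countableI_type)
qed

text \<open>Because \<open>f\<close> is extended by 0, an inadmissible preimage contributes nothing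
  and both branches can always be summed.\<close>

lemma transfer_fun_eq:
  assumes "\<And>x. x \<notin> X \<Longrightarrow> f x = 0"
  shows "transfer_fun \<beta> t f x = f (cons 0 x) + of_real (exp t) * f (cons 1 x)"
proof -
  let ?w = "\<lambda>y. of_real (exp (t * indicator (cyl1 \<beta>) y)) * f y"
  have "{y \<in> X. shift y = x} = {cons 0 x, cons 1 x} \<inter> X"
  proof (intro set_eqI iffI)
    fix y assume y: "y \<in> {y \<in> X. shift y = x}"
    then show "y \<in> {cons 0 x, cons 1 x} \<inter> X" using X_digit[of y 0] cons_shift[of y] by auto
  qed auto
  then have "transfer_fun \<beta> t f x = sum ?w ({cons 0 x, cons 1 x} \<inter> X)"
    by (simp add: transfer_fun_def)
  also have "\<dots> = sum ?w {cons 0 x, cons 1 x}"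
    using assms by (intro sum.mono_neutral_left) auto
  also have "\<dots> = ?w (cons 0 x) + ?w (cons 1 x)"
    by (subst sum.insert) (auto simp: cons_eq_iff)
  also have "\<dots> = f (cons 0 x) + of_real (exp t) * f (cons 1 x)"
    using assms by (cases "cons 1 x \<in> X") (auto simp: cyl1_def indicator_def)
  finally show ?thesis .
qed

text \<open>If two representatives yield different images at \<open>x\<close>, they differ at a
  preimage of \<open>x\<close>; so the exceptional set is covered by the shift of a countable
  set.\<close>

lemma transfer_op_eq:
  assumes f: "f \<in> BV \<beta>" "transfer_fun \<beta> t f \<in> BV \<beta>"
  shows "transfer_op \<beta> t (cls \<beta> f) = cls \<beta> (transfer_fun \<beta> t f)"
  unfolding transfer_op_def
proof (rule cls_image)
  fix g assume g: "g \<in> BV \<beta>" "co_eq \<beta> f g"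
  have "{x \<in> X. transfer_fun \<beta> t f x \<noteq> transfer_fun \<beta> t g x} \<subseteq> shift ` {y \<in> X. f y \<noteq> g y}"
  proof
    fix x assume "x \<in> {x \<in> X. transfer_fun \<beta> t f x \<noteq> transfer_fun \<beta> t g x}"
    then have "f (cons 0 x) \<noteq> g (cons 0 x) \<or> f (cons 1 x) \<noteq> g (cons 1 x)"
      using f g BV_outside transfer_fun_eq by auto
    then obtain d where "f (cons d x) \<noteq> g (cons d x)" by blast
    moreover from this have "cons d x \<in> X" using f g BV_outside by metis
    ultimately show "x \<in> shift ` {y \<in> X. f y \<noteq> g y}" by (intro image_eqI[of _ _ "cons d x"]) auto
  qed
  then show "co_eq \<beta> (transfer_fun \<beta> t f) (transfer_fun \<beta> t g)"
    using g(2) unfolding co_eq_def by (meson countable_image countable_subset)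
qed (use f in auto)

end

section \<open>The space F as a sequence space\<close>

definition single :: "digits \<Rightarrow> digits \<Rightarrow> complex" where
  "single b = (\<lambda>p. if p = b then 1 else 0)"

lemma single_l1: "single b \<in> l1" "infsum (single b) S = (if b \<in> S then 1 else 0)"
  using l1_finite_support(1,2)[of "{b}" "single b"] by (auto simp: single_def)

context beta_expansion
begin

text \<open>This is \<open>l1(Q)\<close>, encoded by families on all sequences so that
  \<open>cons\<close> and \<open>shift\<close> may be applied to indices without domain
  conditions.\<close>

definition ell :: "(digits \<Rightarrow> complex) set" where
  "ell = {a \<in> l1. \<forall>p. p \<notin> Q \<longrightarrow> a p = 0}"

text \<open>\<^term>\<open>stepf a\<close> is the sum of the \<open>a\<^sub>p 1\<^bsub>{x \<le> p}\<^esub>\<close>. The jumps are restricted to \<^term>\<open>Q\<close> to make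
  the representation unique modulo countable sets.\<close>

definition stepf :: "(digits \<Rightarrow> complex) \<Rightarrow> digits \<Rightarrow> complex" where
  "stepf a x = (if x \<in> X then infsum a {p. lex_le x p} else 0)"

lemma ell_l1: "a \<in> ell \<Longrightarrow> a \<in> l1"
  by (simp add: ell_def)

lemma ell_diff: "a \<in> ell \<Longrightarrow> b \<in> ell \<Longrightarrow> (\<lambda>p. a p - b p) \<in> ell"
  by (simp add: ell_def l1_diff)

lemma ell_add: "a \<in> ell \<Longrightarrow> b \<in> ell \<Longrightarrow> (\<lambda>p. a p + b p) \<in> ell"
  by (simp add: ell_def l1_add)

lemma ell_scale: "a \<in> ell \<Longrightarrow> (\<lambda>p. c * a p) \<in> ell"
  by (simp add: ell_def l1_scale)

lemma ell_0: "(\<lambda>p. 0) \<in> ell"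
  by (simp add: ell_def)

lemma ell_truncate: "a \<in> ell \<Longrightarrow> finite S \<Longrightarrow> (\<lambda>p. if p \<in> S then a p else 0) \<in> ell"
  using l1_finite_support(1)[of S "\<lambda>p. if p \<in> S then a p else 0"] by (simp add: ell_def)

lemma stepf_diff:
  assumes "a \<in> l1" "b \<in> l1"
  shows "stepf (\<lambda>p. a p - b p) = (\<lambda>x. stepf a x - stepf b x)"
proof
  fix x
  have "infsum (\<lambda>p. a p + - b p) {p. lex_le x p} =
      infsum a {p. lex_le x p} + infsum (\<lambda>p. - b p) {p. lex_le x p}"
    using assms l1_summable_on l1_summable_on[OF l1_scale(1)[of b "-1"]] by (intro infsum_add) auto
  then show "stepf (\<lambda>p. a p - b p) x = stepf a x - stepf b x"
    by (simp add: stepf_def infsum_uminus)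
qed

lemma stepf_scale: "stepf (\<lambda>p. c * a p) = (\<lambda>x. c * stepf a x)"
  by (auto simp: stepf_def infsum_cmult_right')

lemma stepf_0: "stepf (\<lambda>_. 0) = (\<lambda>_. 0)"
  by (auto simp: stepf_def)

text \<open>The decrements of \<open>h\<close> telescope along every chain.\<close>

lemma BV_dominated:
  assumes out: "\<And>x. x \<notin> X \<Longrightarrow> f x = 0"
    and dom: "\<And>x y. x \<in> X \<Longrightarrow> y \<in> X \<Longrightarrow> less_fun x y \<Longrightarrow> cmod (f y - f x) \<le> h x - h y"
  shows "f \<in> BV \<beta>" "variation \<beta> f \<le> h zero_digits - h q"
proof -
  have *: "chain_sum f n c \<le> h zero_digits - h q" if c: "full_chain \<beta> n c" for n c
  proof -
    have "chain_sum f n c \<le> (\<Sum>i<n. h (c i) - h (c (Suc i)))"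
      using c by (intro sum_mono dom) (auto simp: full_chain_def)
    also have "\<dots> = h (c 0) - h (c n)" by (rule sum_lessThan_telescope')
    finally show ?thesis using c by (simp add: full_chain_def)
  qed
  show "f \<in> BV \<beta>" using variation_le(1)[of f, OF *] out by (simp add: BV_def)
  show "variation \<beta> f \<le> h zero_digits - h q" by (rule variation_le(2)[of f, OF *])
qed

text \<open>The decreasing majorant is the sum of \<open>cmod (a p)\<close> over all
  \<open>p\<close> from \<open>x\<close> upwards. Sup norm and variation each cost one
  \<open>l1norm a\<close>, hence the factor 2.\<close>

lemma stepf_BV:
  assumes a: "a \<in> l1"
  shows "stepf a \<in> BV \<beta>" "bv_norm \<beta> (stepf a) \<le> 2 * l1norm a"
proof -
  define h where "h x = infsum (\<lambda>p. cmod (a p)) {p. lex_le x p}" for x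
  have out: "stepf a x = 0" if "x \<notin> X" for x using that by (simp add: stepf_def)
  have dom: "cmod (stepf a y - stepf a x) \<le> h x - h y"
    if xy: "x \<in> X" "y \<in> X" "less_fun x y" for x y
  proof -
    define A where "A = {p. lex_le x p \<and> less_fun p y}"
    have eq: "{p. lex_le x p} = A \<union> {p. lex_le y p}"
      using xy(3) lex.le_less_linear lex.less_imp_le lex.order_trans unfolding A_def by blast
    have disj: "A \<inter> {p. lex_le y p} = {}" unfolding A_def using lex.not_le by blast
    have "h x = infsum (\<lambda>p. cmod (a p)) A + h y" unfolding h_def eq
      using a disj by (intro infsum_Un_disjoint l1_cmod_summable_on)
    moreover have "stepf a x = infsum a A + stepf a y" unfolding stepf_def eq
      using a disj xy by (auto intro!: infsum_Un_disjoint l1_summable_on)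
    ultimately show ?thesis using cmod_infsum_le[OF a, of A] by (simp add: norm_minus_commute)
  qed
  note BVd = BV_dominated[of "stepf a" h, OF out dom]
  show "stepf a \<in> BV \<beta>" using BVd(1) by blast
  have "0 \<le> h q" unfolding h_def by (intro infsum_nonneg) auto
  moreover have "h zero_digits \<le> l1norm a" unfolding h_def l1norm_def
    using l1_cmod_summable_on[OF a] by (intro infsum_mono2) auto
  moreover have "variation \<beta> (stepf a) \<le> h zero_digits - h q" using BVd(2) by blast
  moreover have "sup_norm \<beta> (stepf a) \<le> l1norm a"
    using cmod_infsum_le_l1norm[OF a] by (intro sup_norm_le) (simp add: stepf_def)
  ultimately show "bv_norm \<beta> (stepf a) \<le> 2 * l1norm a" by (simp add: bv_norm_def)
qed

lemma lex_enumerate: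
  assumes "finite S"
  obtains p :: "nat \<Rightarrow> digits" and m where "S = p ` {..<m}"
    "\<And>i j. i < j \<Longrightarrow> j < m \<Longrightarrow> less_fun (p i) (p j)"
proof -
  have "\<exists>(p :: nat \<Rightarrow> digits) m. S = p ` {..<m} \<and> (\<forall>i j. i < j \<longrightarrow> j < m \<longrightarrow> less_fun (p i) (p j))"
    using assms
  proof (induction rule: lex.finite_linorder_max_induct)
    case empty
    show ?case by (rule exI[of _ "\<lambda>_::nat. zero_digits"], rule exI[of _ 0]) simp
  next
    case (insert b A)
    then obtain p :: "nat \<Rightarrow> digits" and m where p: "A = p ` {..<m}" "\<forall>i j. i < j \<longrightarrow> j < m \<longrightarrow> less_fun (p i) (p j)"
      by blast
    have "insert b A = (p(m := b)) ` {..<Suc m}"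
      using p(1) by (auto simp: lessThan_Suc)
    moreover have "\<forall>i j. i < j \<longrightarrow> j < Suc m \<longrightarrow> less_fun ((p(m := b)) i) ((p(m := b)) j)"
      using p insert by (auto simp: less_Suc_eq)
    ultimately show ?case by blast
  qed
  then show ?thesis using that by blast
qed

text \<open>Let \<open>p 0, ..., p k\<close> be the jumps in increasing order. A sample point
  \<open>z i\<close> is taken in the uncountable gap below each \<open>p i\<close>, away from the
  countable set where \<open>g\<close> deviates. Then
  \<open>g (z i) - g (z (Suc i)) = a (p i)\<close>, so the variation of \<open>g\<close> controls
  all jumps but the last.\<close>

lemma l1norm_le_bv_norm_finite:
  assumes S: "finite S" "S \<subseteq> Q" "\<And>p. p \<notin> S \<Longrightarrow> a p = 0"
    and g: "g \<in> BV \<beta>" "co_eq \<beta> (stepf a) g"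
  shows "l1norm a \<le> bv_norm \<beta> g"
proof -
  obtain p :: "nat \<Rightarrow> digits" and m where p: "S = p ` {..<m}" "\<And>i j. i < j \<Longrightarrow> j < m \<Longrightarrow> less_fun (p i) (p j)"
    using lex_enumerate[OF S(1)] by blast
  have inj: "inj_on p {..<m}"
  proof (rule linorder_inj_onI')
    fix i j assume "i \<in> {..<m}" "j \<in> {..<m}" "i < j"
    then show "p i \<noteq> p j" using p(2)[of i j] less_fun_irrefl by auto
  qed
  have l1: "l1norm a = (\<Sum>j<m. cmod (a (p j)))"
    using l1_finite_support(3)[OF S(1,3)] inj by (simp add: p(1) sum.reindex)
  show ?thesis
  proof (cases m)
    case 0
    then show ?thesis using l1 bv_norm_nonneg[OF g(1)] by simp
  next
    case (Suc k)
    \<comment> \<open>The two end points are excluded as well, because the sample points must be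
      interior points of a full chain.\<close>
    define C where "C = {x \<in> X. stepf a x \<noteq> g x} \<union> {zero_digits, q}"
    have "countable C" using g(2) by (simp add: C_def co_eq_def)
    define pr where "pr i = (if i = 0 then zero_digits else p (i - 1))" for i
    have "\<exists>z. z \<in> X \<and> less_fun (pr i) z \<and> less_fun z (p i) \<and> z \<notin> C" if "i < m" for i
    proof -
      have "p i \<in> Q" using S(2) p(1) that by auto
      moreover have "less_fun (pr i) (p i)"
        using zero_less_Q[OF \<open>p i \<in> Q\<close>] p(2)[of "i - 1" i] that
        by (cases "i = 0") (simp_all add: pr_def)
      ultimately have "uncountable {x \<in> X. less_fun (pr i) x \<and> less_fun x (p i)}"
        by (intro uncountable_between)
      then have "\<not> {x \<in> X. less_fun (pr i) x \<and> less_fun x (p i)} \<subseteq> C"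
        by (rule contrapos_nn) (rule countable_subset[OF _ \<open>countable C\<close>])
      then show ?thesis by blast
    qed
    then obtain z where z: "\<And>i. i < m \<Longrightarrow> z i \<in> X" "\<And>i. i < m \<Longrightarrow> less_fun (pr i) (z i)"
      "\<And>i. i < m \<Longrightarrow> less_fun (z i) (p i)" "\<And>i. i < m \<Longrightarrow> z i \<notin> C" by metis
    have gz: "g (z i) = (\<Sum>j\<in>{i..<m}. a (p j))" if i: "i < m" for i
    proof -
      have "lex_le (z i) (p j) \<longleftrightarrow> i \<le> j" if j: "j < m" for j
      proof
        assume le: "lex_le (z i) (p j)"
        show "i \<le> j"
        proof (rule ccontr)
          assume "\<not> i \<le> j"
          then have "lex_le (p j) (pr i)"
            using p(2)[of j "i - 1"] i by (cases "j = i - 1") (auto simp: pr_def lex_le_def)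
          then show False using le z(2)[OF i] lex.le_less_trans lex.not_le by blast
        qed
      next
        assume "i \<le> j"
        then have "lex_le (p i) (p j)" using p(2)[of i j] j by (cases "i = j") (auto simp: lex_le_def)
        then show "lex_le (z i) (p j)" using z(3)[OF i] lex.less_imp_le lex.order_trans by blast
      qed
      then have "S \<inter> {x. lex_le (z i) x} = p ` {i..<m}" using p(1) by auto
      then have "stepf a (z i) = (\<Sum>x\<in>p ` {i..<m}. a x)"
        using z(1)[OF i] l1_finite_support(2)[OF S(1,3)] by (simp add: stepf_def)
      also have "\<dots> = (\<Sum>j\<in>{i..<m}. a (p j))"
        using inj by (subst sum.reindex) (auto intro: inj_on_subset)
      finally show ?thesis using z(1,4)[OF i] by (simp add: C_def)
    qed
    define c where "c = (\<lambda>i. if i = 0 then zero_digits else if i \<le> m then z (i - 1) else q)"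
    have "less_fun (z i) (z (Suc i))" if "Suc i < m" for i
      using z(3)[of i] z(2)[of "Suc i"] that less_fun_trans by (simp add: pr_def)
    then have "full_chain \<beta> (Suc m) c" unfolding c_def
      using z(1,4) by (intro full_chain_extend) (auto simp: C_def)
    then have "chain_sum g (Suc m) c \<le> variation \<beta> g" using chain_sum_le_variation g(1) by blast
    moreover have "(\<Sum>i<k. cmod (a (p i))) \<le> chain_sum g (Suc m) c"
    proof -
      have "(\<Sum>i<k. cmod (a (p i))) = (\<Sum>i<k. cmod (g (c (Suc (Suc i))) - g (c (Suc i))))"
      proof (rule sum.cong[OF refl])
        fix i assume "i \<in> {..<k}"
        then have i: "Suc i < m" using Suc by simp
        then have "g (z i) = a (p i) + g (z (Suc i))"
          using gz[of i] gz[of "Suc i"] by (simp add: sum.atLeast_Suc_lessThan)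
        then show "cmod (a (p i)) = cmod (g (c (Suc (Suc i))) - g (c (Suc i)))"
          using i by (simp add: c_def norm_minus_commute)
      qed
      also have "\<dots> \<le> (\<Sum>i<Suc k. cmod (g (c (Suc (Suc i))) - g (c (Suc i))))" by simp
      also have "\<dots> \<le> chain_sum g (Suc m) c" unfolding Suc sum.lessThan_Suc_shift[of _ "Suc k"] by simp
      finally show ?thesis .
    qed
    \<comment> \<open>No sample point follows the last jump; its size is the value of
      \<open>g\<close> at \<open>z k\<close>, which the sup norm controls.\<close>
    moreover have "cmod (a (p k)) \<le> sup_norm \<beta> g"
      using gz[of k] cmod_le_sup_norm[OF g(1) z(1)[of k]] Suc by simp
    ultimately show ?thesis unfolding l1 bv_norm_def Suc by simp
  qed
qed

lemma quot_norm_stepf_le: "a \<in> l1 \<Longrightarrow> quot_norm \<beta> (cls \<beta> (stepf a)) \<le> 2 * l1norm a"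
  using quot_norm_le[of "stepf a" "stepf a"] stepf_BV[of a] by simp

lemma quot_norm_stepf_ge:
  assumes a: "a \<in> ell"
  shows "l1norm a \<le> quot_norm \<beta> (cls \<beta> (stepf a))"
proof (rule field_le_epsilon)
  fix e :: real assume "0 < e"
  \<comment> \<open>The truncation error \<open>d\<close> will enter three times: once in the l1
    norm and twice through the upper bound \<open>2 * l1norm d\<close>.\<close>
  then have "0 < e / 3" by simp
  from l1_truncate[OF ell_l1[OF a] this]
  obtain S where S: "finite S" "l1norm (\<lambda>p. a p - (if p \<in> S then a p else 0)) < e / 3" .
  define b where "b = (\<lambda>p. if p \<in> S then a p else 0)"
  define d where "d = (\<lambda>p. a p - b p)"
  have b: "b \<in> ell" unfolding b_def using ell_truncate a S by blast
  have d: "d \<in> ell" unfolding d_def using ell_diff a b by blast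
  have ld: "l1norm d < e / 3" using S(2) by (simp add: b_def d_def)
  have "l1norm b \<le> quot_norm \<beta> (cls \<beta> (stepf b))"
  proof (rule quot_norm_ge)
    show "stepf b \<in> BV \<beta>" using stepf_BV ell_l1 b by blast
    show "l1norm b \<le> bv_norm \<beta> g" if "g \<in> BV \<beta>" "co_eq \<beta> (stepf b) g" for g
      using that S a by (intro l1norm_le_bv_norm_finite[of "S \<inter> Q"]) (auto simp: b_def ell_def)
  qed
  also have "stepf b = (\<lambda>x. stepf a x - stepf d x)"
    using stepf_diff[of a d] ell_l1[OF a] ell_l1[OF d] by (simp add: d_def)
  also have "quot_norm \<beta> (cls \<beta> \<dots>) \<le> quot_norm \<beta> (cls \<beta> (stepf a)) + quot_norm \<beta> (cls \<beta> (stepf d))"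
    using stepf_BV ell_l1 a d by (intro quot_norm_diff) auto
  also have "quot_norm \<beta> (cls \<beta> (stepf d)) \<le> 2 * l1norm d"
    using quot_norm_stepf_le ell_l1 d by blast
  finally have "l1norm b \<le> quot_norm \<beta> (cls \<beta> (stepf a)) + 2 * l1norm d" by simp
  moreover have "l1norm a \<le> l1norm b + l1norm d"
    using l1_add(2)[OF ell_l1[OF b] ell_l1[OF d]] by (simp add: d_def)
  ultimately show "l1norm a \<le> quot_norm \<beta> (cls \<beta> (stepf a)) + e" using ld by linarith
qed

lemma stepf_single: "stepf (single b) x = indicator {x \<in> X. lex_le x b} x"
  by (simp add: stepf_def single_l1(2) indicator_def)

lemma single_ell: "b \<in> Q \<Longrightarrow> single b \<in> ell"
  by (auto simp: ell_def single_l1(1)) (auto simp: single_def)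

section \<open>Indicators of intervals as step functions modulo countable sets\<close>

definition has_stepf :: "(digits \<Rightarrow> complex) \<Rightarrow> bool" where
  "has_stepf f \<longleftrightarrow> f \<in> BV \<beta> \<and> (\<exists>a\<in>ell. co_eq \<beta> f (stepf a))"

lemma has_stepf_diff:
  assumes "has_stepf f" "has_stepf g"
  shows "has_stepf (\<lambda>x. f x - g x)"
proof -
  obtain a b where ab: "a \<in> ell" "co_eq \<beta> f (stepf a)" "b \<in> ell" "co_eq \<beta> g (stepf b)"
    using assms by (auto simp: has_stepf_def)
  then have "co_eq \<beta> (\<lambda>x. f x - g x) (stepf (\<lambda>p. a p - b p))"
    using co_eq_diff stepf_diff ell_l1 by simp
  then show ?thesis using ab ell_diff BV_diff(1) assms unfolding has_stepf_def by blast
qed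

lemma has_stepf_scale:
  assumes "has_stepf f"
  shows "has_stepf (\<lambda>x. c * f x)"
proof -
  obtain a where a: "a \<in> ell" "co_eq \<beta> f (stepf a)" "f \<in> BV \<beta>"
    using assms by (auto simp: has_stepf_def)
  have "chain_sum (\<lambda>x. c * f x) n ch \<le> cmod c * variation \<beta> f" if "full_chain \<beta> n ch" for n ch
  proof -
    have "chain_sum (\<lambda>x. c * f x) n ch = cmod c * chain_sum f n ch"
      by (simp add: sum_distrib_left norm_mult flip: right_diff_distrib)
    then show ?thesis using chain_sum_le_variation[OF a(3) that] by (simp add: mult_left_mono)
  qed
  from variation_le(1)[of "\<lambda>x. c * f x", OF this] have "(\<lambda>x. c * f x) \<in> BV \<beta>"
    using a(3) by (simp add: BV_def)
  moreover have "co_eq \<beta> (\<lambda>x. c * f x) (stepf (\<lambda>p. c * a p))"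
    using co_eq_scale[OF a(2)] by (simp add: stepf_scale)
  ultimately show ?thesis using a ell_scale unfolding has_stepf_def by blast
qed

lemma has_stepf_lower_set:
  assumes D: "D \<subseteq> X" "\<And>x y. x \<in> D \<Longrightarrow> y \<in> X \<Longrightarrow> less_fun y x \<Longrightarrow> y \<in> D"
  shows "has_stepf (indicator D)"
proof -
  have "indicator D \<in> BV \<beta>"
  proof (rule BV_dominated)
    show "cmod (indicator D y - indicator D x) \<le> indicator D x - indicator D y"
      if "x \<in> X" "y \<in> X" "less_fun x y" for x y
      using D(2)[of y x] that by (auto simp: indicator_def)
    show "indicator D x = 0" if "x \<notin> X" for x
      using D(1) that by (auto simp: indicator_def)
  qed
  moreover have "\<exists>a\<in>ell. co_eq \<beta> (indicator D) (stepf a)"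
  proof (rule lower_set_eq[OF D])
    assume "countable D"
    then have "co_eq \<beta> (indicator D) (stepf (\<lambda>_. 0))" unfolding co_eq_def stepf_0
      by (rule countable_subset[rotated]) (auto simp: indicator_def)
    then show ?thesis using ell_0 by blast
  next
    fix b assume b: "b \<in> Q" "countable {x \<in> X. x \<in> D \<longleftrightarrow> \<not> lex_le x b}"
    have "co_eq \<beta> (indicator D) (stepf (single b))"
      unfolding co_eq_def stepf_single using b(2)
      by (rule countable_subset[rotated]) (auto simp: indicator_def)
    then show ?thesis using single_ell[OF b(1)] by blast
  qed auto
  ultimately show ?thesis by (simp add: has_stepf_def)
qed

lemma has_stepf_interval:
  assumes I: "shift_interval \<beta> I"
  shows "has_stepf (indicator I)"
proof -
  define U where "U = {x \<in> X. \<exists>y\<in>I. lex_le x y}"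
  \<comment> \<open>\<open>I\<close> is its downward closure \<open>U\<close> minus the points
    strictly below all of \<open>I\<close>. The existence clause keeps \<open>D\<close> inside
    \<open>U\<close> when \<open>I\<close> is empty.\<close>
  define D where "D = {x \<in> X. (\<exists>y\<in>I. lex_le x y) \<and> (\<forall>y\<in>I. less_fun x y)}"
  have "x \<in> I \<longleftrightarrow> x \<in> U \<and> x \<notin> D" for x
  proof
    assume x: "x \<in> I"
    then have "x \<in> X" using I unfolding shift_interval_def by blast
    then show "x \<in> U \<and> x \<notin> D" using x less_fun_irrefl[of x] unfolding U_def D_def by auto
  next
    assume x: "x \<in> U \<and> x \<notin> D"
    then obtain y where y: "x \<in> X" "y \<in> I" "lex_le x y" unfolding U_def by blast
    then obtain z where z: "z \<in> I" "lex_le z x"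
      using x unfolding D_def by (auto simp: lex.not_less)
    show "x \<in> I"
    proof (cases "x = y \<or> x = z")
      case False
      then have "less_fun z x" "less_fun x y" using y z by (auto simp: lex_le_def)
      then show ?thesis using I y z unfolding shift_interval_def by blast
    qed (use y z in auto)
  qed
  moreover have "D \<subseteq> U" by (auto simp: D_def U_def)
  ultimately have "indicator I = (\<lambda>x. indicator U x - indicator D x :: complex)"
    by (auto simp: fun_eq_iff indicator_def)
  moreover have "has_stepf (indicator U)"
  proof (rule has_stepf_lower_set)
    show "z \<in> U" if "x \<in> U" "z \<in> X" "less_fun z x" for x z
      using that lex.less_le_trans[of z x] lex.less_imp_le unfolding U_def by blast
  qed (auto simp: U_def)
  moreover have "has_stepf (indicator D)"
  proof (rule has_stepf_lower_set)
    show "z \<in> D" if "x \<in> D" "z \<in> X" "less_fun z x" for x z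
      using that lex.less_le_trans[of z x] lex.less_imp_le less_fun_trans[of z x] unfolding D_def by blast
  qed (auto simp: D_def)
  ultimately show ?thesis using has_stepf_diff by simp
qed

lemma has_stepf_interval_span:
  assumes "f \<in> interval_span \<beta>"
  shows "has_stepf f"
proof -
  obtain n a I where f: "f = (\<lambda>x. \<Sum>i<n. a i * indicator (I i) x)"
    and I: "\<forall>i<(n::nat). shift_interval \<beta> (I i)"
    using assms unfolding interval_span_def by blast
  have "has_stepf (\<lambda>x. \<Sum>i<m. a i * indicator (I i) x)" if "m \<le> n" for m
    using that
  proof (induction m)
    case 0
    have "has_stepf (indicator {})" by (rule has_stepf_lower_set) auto
    moreover have "indicator {} = (\<lambda>x::digits. 0 :: complex)" by auto
    ultimately show ?case by simp
  next
    case (Suc m)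
    have "shift_interval \<beta> (I m)" using I Suc.prems by simp
    then have "has_stepf (\<lambda>x. - a m * indicator (I m) x)"
      by (intro has_stepf_scale has_stepf_interval)
    moreover have "has_stepf (\<lambda>x. \<Sum>i<m. a i * indicator (I i) x)" using Suc by simp
    ultimately have "has_stepf (\<lambda>x. (\<Sum>i<m. a i * indicator (I i) x) - - a m * indicator (I m) x)"
      by (rule has_stepf_diff[rotated])
    then show ?case by simp
  qed
  then show ?thesis using f by simp
qed

lemma stepf_interval_span:
  assumes "finite S" "\<And>p. p \<notin> S \<Longrightarrow> a p = 0"
  shows "stepf a \<in> interval_span \<beta>"
proof -
  obtain h where h: "bij_betw h {0..<card S} S"
    using ex_bij_betw_nat_finite[OF assms(1)] by blast
  have "stepf a x = (\<Sum>i<card S. a (h i) * indicator {x \<in> X. lex_le x (h i)} x)" for x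
  proof -
    have "stepf a x = (if x \<in> X then \<Sum>p\<in>S \<inter> {p. lex_le x p}. a p else 0)"
      using l1_finite_support(2)[OF assms] by (simp add: stepf_def)
    also have "\<dots> = (\<Sum>p\<in>S. a p * indicator {x \<in> X. lex_le x p} x)"
      using assms(1) by (auto simp: sum.inter_restrict indicator_def intro!: sum.cong)
    also have "\<dots> = (\<Sum>i\<in>{0..<card S}. a (h i) * indicator {x \<in> X. lex_le x (h i)} x)"
      by (rule sum.reindex_bij_betw[OF h, symmetric])
    finally show ?thesis by (simp add: atLeast0LessThan)
  qed
  moreover have "shift_interval \<beta> {x \<in> X. lex_le x p}" for p
    unfolding shift_interval_def using lex.less_imp_le lex.order_trans by blast
  ultimately show ?thesis unfolding interval_span_def
    by (intro CollectI exI[of _ "card S"] exI[of _ "\<lambda>i. a (h i)"] exI[of _ "\<lambda>i. {x \<in> X. lex_le x (h i)}"]) auto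
qed

text \<open>Truncation approximates every step function by the interval span. Conversely, the lower
  norm bound makes the jump families of an approximating sequence Cauchy in l1; completeness
  supplies the limit family, and definiteness of the quotient norm identifies the class.\<close>

lemma F_space_eq: "F_space \<beta> = (\<lambda>a. cls \<beta> (stepf a)) ` ell"
proof (intro set_eqI iffI)
  fix A assume "A \<in> (\<lambda>a. cls \<beta> (stepf a)) ` ell"
  then obtain a where a: "a \<in> ell" "A = cls \<beta> (stepf a)" by blast
  have "A \<in> BV_quot \<beta>"
    using a stepf_BV ell_l1 unfolding BV_quot_def cls_def by (auto intro: quotientI)
  moreover have "\<exists>f\<in>interval_span \<beta>. quot_norm \<beta> (diff_cls \<beta> A (cls \<beta> f)) < e" if "e > 0" for e
  proof -
    have "e / 2 > 0" using that by simp
    from l1_truncate[OF ell_l1[OF a(1)] this]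
    obtain S where S: "finite S" "l1norm (\<lambda>p. a p - (if p \<in> S then a p else 0)) < e / 2" .
    define b where "b = (\<lambda>p. if p \<in> S then a p else 0)"
    have b: "b \<in> ell" unfolding b_def using ell_truncate a S by blast
    have "diff_cls \<beta> A (cls \<beta> (stepf b)) = cls \<beta> (stepf (\<lambda>p. a p - b p))"
      using a b stepf_BV ell_l1 by (simp add: diff_cls_eq stepf_diff)
    then have "quot_norm \<beta> (diff_cls \<beta> A (cls \<beta> (stepf b))) \<le> 2 * l1norm (\<lambda>p. a p - b p)"
      using quot_norm_stepf_le ell_l1[OF ell_diff[OF a(1) b]] by simp
    moreover have "stepf b \<in> interval_span \<beta>"
      using S(1) by (intro stepf_interval_span[of S]) (auto simp: b_def)
    ultimately show ?thesis using S(2) unfolding b_def by (intro bexI) auto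
  qed
  ultimately show "A \<in> F_space \<beta>" by (simp add: F_space_def)
next
  fix A assume A: "A \<in> F_space \<beta>"
  then have "A \<in> BV_quot \<beta>" by (simp add: F_space_def)
  then obtain f where f: "f \<in> BV \<beta>" "A = cls \<beta> f"
    unfolding BV_quot_def cls_def by (auto elim: quotientE)
  have "\<exists>a\<in>ell. quot_norm \<beta> (cls \<beta> (\<lambda>x. f x - stepf a x)) < e" if "e > 0" for e
  proof -
    have "\<exists>g\<in>interval_span \<beta>. quot_norm \<beta> (diff_cls \<beta> A (cls \<beta> g)) < e"
      using A that unfolding F_space_def by blast
    then obtain g where g: "g \<in> interval_span \<beta>" "quot_norm \<beta> (diff_cls \<beta> A (cls \<beta> g)) < e"
      by blast
    obtain a where a: "a \<in> ell" "co_eq \<beta> g (stepf a)" "g \<in> BV \<beta>"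
      using has_stepf_interval_span[OF g(1)] by (auto simp: has_stepf_def)
    have "cls \<beta> g = cls \<beta> (stepf a)" using a stepf_BV ell_l1 by (simp add: cls_eq_iff)
    then show ?thesis using g(2) f a stepf_BV ell_l1 by (intro bexI[of _ a]) (auto simp: diff_cls_eq)
  qed
  then have "\<exists>a\<in>ell. quot_norm \<beta> (cls \<beta> (\<lambda>x. f x - stepf a x)) < 1 / Suc n" for n by simp
  then obtain a where a: "\<And>n. a n \<in> ell"
    "\<And>n. quot_norm \<beta> (cls \<beta> (\<lambda>x. f x - stepf (a n) x)) < 1 / Suc n" by metis
  note BVs = stepf_BV(1)[OF ell_l1]
  have fd: "(\<lambda>x. f x - stepf b x) \<in> BV \<beta>" if "b \<in> ell" for b
    using f that BVs BV_diff(1) by blast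
  have cauchy: "l1norm (\<lambda>p. a m p - a n p) < 1 / Suc n + 1 / Suc m" for m n
  proof -
    have "l1norm (\<lambda>p. a m p - a n p) \<le> quot_norm \<beta> (cls \<beta> (stepf (\<lambda>p. a m p - a n p)))"
      using quot_norm_stepf_ge ell_diff a by blast
    also have "stepf (\<lambda>p. a m p - a n p) = (\<lambda>x. (f x - stepf (a n) x) - (f x - stepf (a m) x))"
      using stepf_diff ell_l1 a by (simp add: fun_eq_iff)
    also have "quot_norm \<beta> (cls \<beta> \<dots>) \<le> quot_norm \<beta> (cls \<beta> (\<lambda>x. f x - stepf (a n) x))
        + quot_norm \<beta> (cls \<beta> (\<lambda>x. f x - stepf (a m) x))"
      by (rule quot_norm_diff[OF fd[OF a(1)] fd[OF a(1)]])
    finally show ?thesis using a(2)[of m] a(2)[of n] by linarith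
  qed
  have cauchy_e: "\<exists>N. \<forall>m\<ge>N. \<forall>n\<ge>N. l1norm (\<lambda>p. a m p - a n p) < e" if e: "e > 0" for e
  proof -
    obtain N where N: "inverse (real (Suc N)) < e / 2" using reals_Archimedean[of "e / 2"] half_gt_zero[OF e] by blast
    have "l1norm (\<lambda>p. a m p - a n p) < e" if "m \<ge> N" "n \<ge> N" for m n
    proof -
      have "1 / real (Suc k) < e / 2" if "k \<ge> N" for k
      proof -
        have "1 / real (Suc k) \<le> inverse (real (Suc N))"
          using that by (simp add: inverse_eq_divide frac_le)
        then show ?thesis using N by linarith
      qed
      from this[of m] this[of n] show ?thesis using cauchy[of m n] that by linarith
    qed
    then show ?thesis by blast
  qed
  obtain b where b: "b \<in> l1" "(\<lambda>n. l1norm (\<lambda>p. a n p - b p)) \<longlonglongrightarrow> 0" "\<And>p. (\<lambda>n. a n p) \<longlonglongrightarrow> b p"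
    using l1_complete[of a, OF ell_l1[OF a(1)] cauchy_e] by blast
  have "b p = 0" if "p \<notin> Q" for p
  proof -
    have "(\<lambda>n. a n p) = (\<lambda>_. 0)" using that a by (auto simp: ell_def)
    with b(3)[of p] have "(\<lambda>_. 0) \<longlonglongrightarrow> b p" by simp
    then show ?thesis unfolding LIMSEQ_const_iff by simp
  qed
  then have "b \<in> ell" using b by (simp add: ell_def)
  have "co_eq \<beta> (\<lambda>x. f x - stepf b x) (\<lambda>_. 0)"
  proof (rule quot_norm_eq_0)
    show "(\<lambda>x. f x - stepf b x) \<in> BV \<beta>" using fd \<open>b \<in> ell\<close> by blast
    fix e :: real assume e: "e > 0"
    have "(\<lambda>n. 1 / Suc n + 2 * l1norm (\<lambda>p. a n p - b p)) \<longlonglongrightarrow> 0 + 2 * 0"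
      using LIMSEQ_inverse_real_of_nat by (intro tendsto_intros b) (simp add: inverse_eq_divide)
    then have "eventually (\<lambda>n. 1 / Suc n + 2 * l1norm (\<lambda>p. a n p - b p) < e) sequentially"
      using e by (intro order_tendstoD) auto
    then obtain n where n: "1 / Suc n + 2 * l1norm (\<lambda>p. a n p - b p) < e"
      by (auto simp: eventually_sequentially)
    have d: "(\<lambda>p. b p - a n p) \<in> ell" using ell_diff \<open>b \<in> ell\<close> a by blast
    have "(\<lambda>x. f x - stepf b x) = (\<lambda>x. (f x - stepf (a n) x) - stepf (\<lambda>p. b p - a n p) x)"
      using stepf_diff b(1) ell_l1 a by simp
    then have "quot_norm \<beta> (cls \<beta> (\<lambda>x. f x - stepf b x)) \<le>
        quot_norm \<beta> (cls \<beta> (\<lambda>x. f x - stepf (a n) x)) + quot_norm \<beta> (cls \<beta> (stepf (\<lambda>p. b p - a n p)))"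
      using quot_norm_diff[OF fd[OF a(1)[of n]] BVs[OF d]] by simp
    also have "quot_norm \<beta> (cls \<beta> (stepf (\<lambda>p. b p - a n p))) \<le> 2 * l1norm (\<lambda>p. a n p - b p)"
      using quot_norm_stepf_le[OF ell_l1[OF d]] by (simp add: l1norm_minus_commute[of b])
    finally show "quot_norm \<beta> (cls \<beta> (\<lambda>x. f x - stepf b x)) < e" using a(2)[of n] n by linarith
  qed
  then have "co_eq \<beta> f (stepf b)" by (simp add: co_eq_def)
  then have "A = cls \<beta> (stepf b)" using f BVs[OF \<open>b \<in> ell\<close>] by (simp add: cls_eq_iff)
  then show "A \<in> (\<lambda>a. cls \<beta> (stepf a)) ` ell" using \<open>b \<in> ell\<close> by blast
qed

end

section \<open>The transfer operator on jump sequences\<close>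

text \<open>On indicators \<open>e\<^sub>p = 1\<^bsub>{x \<le> p}\<^esub>\<close> the transfer operator acts by
  \<open>e\<^sub>p \<mapsto> exp (t p\<^sub>0) e\<^bsub>\<sigma> p\<^esub> + p\<^sub>0 e\<^sub>q\<close>; the first summand is \<open>wop\<close> and the coefficient of the
  rank-one second one is \<open>lead\<close>.\<close>

definition wop :: "real \<Rightarrow> (digits \<Rightarrow> complex) \<Rightarrow> digits \<Rightarrow> complex" where
  "wop t a r = a (cons 0 r) + of_real (exp t) * a (cons 1 r)"

definition lead :: "(digits \<Rightarrow> complex) \<Rightarrow> complex" where
  "lead a = infsum a {p. 0 < p 0}"

text \<open>With \<open>b = q\<close> this is the transfer operator in jump coordinates
  (\<open>transfer_fun_stepf\<close>).\<close>

definition lop :: "real \<Rightarrow> digits \<Rightarrow> (digits \<Rightarrow> complex) \<Rightarrow> digits \<Rightarrow> complex" where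
  "lop t b a = (\<lambda>p. wop t a p + lead a * single b p)"

text \<open>Partial sums of the Neumann series for the inverse of
  \<open>\<mu> - wop t\<close>.\<close>

definition neumann :: "real \<Rightarrow> complex \<Rightarrow> nat \<Rightarrow> (digits \<Rightarrow> complex) \<Rightarrow> digits \<Rightarrow> complex" where
  "neumann t \<mu> n a = (\<lambda>p. \<Sum>k<n. inverse \<mu> ^ Suc k * (wop t ^^ k) a p)"

lemma H_Suc: "H (Suc n) t p = exp (t * real (p 0)) * H n t (shift p)"
  unfolding H_def sum.lessThan_Suc_shift by (simp add: shift_def distrib_left exp_add)

lemma lead_diff: "a \<in> l1 \<Longrightarrow> b \<in> l1 \<Longrightarrow> lead (\<lambda>p. a p - b p) = lead a - lead b"
  unfolding lead_def
  using infsum_add[of a "{p. 0 < p 0}" "\<lambda>p. - b p"] l1_summable_on[of a]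
    l1_summable_on[OF l1_scale(1)[of b "-1"]] by (simp add: infsum_uminus)

lemma lead_scale: "lead (\<lambda>p. c * a p) = c * lead a"
  unfolding lead_def by (rule infsum_cmult_right')

lemma lead_bound: "a \<in> l1 \<Longrightarrow> cmod (lead a) \<le> l1norm a"
  unfolding lead_def by (rule cmod_infsum_le_l1norm)

lemma wop_linear:
  "(wop t ^^ k) (\<lambda>p. c * a p - d * b p) = (\<lambda>p. c * (wop t ^^ k) a p - d * (wop t ^^ k) b p)"
  by (induction k) (auto simp: wop_def algebra_simps)

lemma wop_add: "wop t (\<lambda>p. a p + b p) = (\<lambda>p. wop t a p + wop t b p)"
  by (auto simp: wop_def algebra_simps)

lemma wop_scale: "wop t (\<lambda>p. c * a p) = (\<lambda>p. c * wop t a p)"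
  by (auto simp: wop_def algebra_simps)

text \<open>By telescoping, the partial sums are a right inverse up to a remainder; this yields
  existence of solutions.\<close>

lemma neumann_identity:
  assumes "\<mu> \<noteq> 0"
  shows "\<mu> * neumann t \<mu> n a p - wop t (neumann t \<mu> n a) p = a p - inverse \<mu> ^ n * (wop t ^^ n) a p"
proof (induction n)
  case 0
  then show ?case by (simp add: neumann_def wop_def)
next
  case (Suc n)
  have eq: "neumann t \<mu> (Suc n) a = (\<lambda>p. neumann t \<mu> n a p + inverse \<mu> ^ Suc n * (wop t ^^ n) a p)"
    by (simp add: neumann_def)
  have "wop t (neumann t \<mu> (Suc n) a) p = wop t (neumann t \<mu> n a) p + inverse \<mu> ^ Suc n * (wop t ^^ Suc n) a p"
    unfolding eq wop_add wop_scale by simp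
  then have "\<mu> * neumann t \<mu> (Suc n) a p - wop t (neumann t \<mu> (Suc n) a) p =
      a p - inverse \<mu> ^ n * (wop t ^^ n) a p
      + \<mu> * (inverse \<mu> ^ Suc n * (wop t ^^ n) a p) - inverse \<mu> ^ Suc n * (wop t ^^ Suc n) a p"
    unfolding Suc[symmetric] eq by (simp only: distrib_left) simp
  also have "\<mu> * (inverse \<mu> ^ Suc n * (wop t ^^ n) a p) = inverse \<mu> ^ n * (wop t ^^ n) a p"
    using assms by simp
  finally show ?case by simp
qed

text \<open>The same on the other side: a left inverse up to a remainder, which yields bounds for
  given solutions.\<close>

lemma neumann_resolvent:
  assumes "\<mu> \<noteq> 0"
  shows "neumann t \<mu> n (\<lambda>p. \<mu> * b p - wop t b p) p = b p - inverse \<mu> ^ n * (wop t ^^ n) b p"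
proof (induction n)
  case (Suc n)
  have "(wop t ^^ n) (\<lambda>p. \<mu> * b p - wop t b p) p = \<mu> * (wop t ^^ n) b p - (wop t ^^ Suc n) b p"
    using wop_linear[where t = t and k = n and c = \<mu> and a = b and d = 1 and b = "wop t b"] by (simp add: funpow_swap1)
  then have "neumann t \<mu> (Suc n) (\<lambda>p. \<mu> * b p - wop t b p) p =
      b p - inverse \<mu> ^ n * (wop t ^^ n) b p
      + inverse \<mu> ^ Suc n * (\<mu> * (wop t ^^ n) b p - (wop t ^^ Suc n) b p)"
    using Suc by (simp add: neumann_def)
  also have "inverse \<mu> ^ Suc n * (\<mu> * (wop t ^^ n) b p - (wop t ^^ Suc n) b p)
      = inverse \<mu> ^ n * (wop t ^^ n) b p - inverse \<mu> ^ Suc n * (wop t ^^ Suc n) b p"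
    using assms by (simp add: right_diff_distrib)
  finally show ?case by simp
qed (simp add: neumann_def)

lemma wop_single:
  assumes "b 0 = 0 \<or> b 0 = 1"
  shows "wop t (\<lambda>p. c * single b p) = (\<lambda>p. c * of_real (exp (t * real (b 0))) * single (shift b) p)"
proof
  fix p
  have "single b (cons d p) = (if d = b 0 then single (shift b) p else 0)" for d
    using cons_eq_iff[of d p b] by (simp add: single_def)
  then have "wop t (\<lambda>p. c * single b p) p = c * (if 0 = b 0 then single (shift b) p else 0)
      + of_real (exp t) * (c * (if 1 = b 0 then single (shift b) p else 0))"
    unfolding wop_def by (simp only:)
  then show "wop t (\<lambda>p. c * single b p) p = c * of_real (exp (t * real (b 0))) * single (shift b) p"
    using assms by (elim disjE) simp_all
qed

text \<open>Each application of \<open>wop\<close> moves mass from an index to its shift. Read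
  backwards, the sum runs over the disjoint images under \<open>cons 0\<close> and
  \<open>cons 1\<close>, and \<open>n\<close> such steps collect the weight \<open>H n t p\<close>.
  Working with finite sums avoids presupposing summability.\<close>

lemma wop_weighted_sum:
  assumes "\<And>r. 0 \<le> w r" "finite T"
  shows "\<exists>T'. finite T' \<and> (\<Sum>r\<in>T. w r * cmod ((wop t ^^ n) a r))
    \<le> (\<Sum>p\<in>T'. w ((shift ^^ n) p) * H n t p * cmod (a p))"
  using assms
proof (induction n arbitrary: a)
  case 0
  then show ?case by (intro exI[of _ T]) (simp add: H_def)
next
  case (Suc n)
  obtain T' where T': "finite T'" "(\<Sum>r\<in>T. w r * cmod ((wop t ^^ n) (wop t a) r))
      \<le> (\<Sum>p\<in>T'. w ((shift ^^ n) p) * H n t p * cmod (wop t a p))"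
    using Suc by blast
  define v where "v p = w ((shift ^^ n) p) * H n t p" for p
  have v: "0 \<le> v p" for p using Suc.prems by (simp add: v_def H_def)
  define f where "f p = v (shift p) * exp (t * real (p 0)) * cmod (a p)" for p
  have inj: "inj_on (cons d) T'" for d by (metis cons_simps(3) inj_onI)
  have "(\<Sum>p\<in>T'. v p * cmod (wop t a p)) \<le> (\<Sum>p\<in>T'. f (cons 0 p) + f (cons 1 p))"
  proof (rule sum_mono)
    fix p
    have "cmod (wop t a p) \<le> cmod (a (cons 0 p)) + exp t * cmod (a (cons 1 p))"
      unfolding wop_def using norm_triangle_ineq by (rule order_trans) (simp add: norm_mult)
    from mult_left_mono[OF this v[of p]]
    show "v p * cmod (wop t a p) \<le> f (cons 0 p) + f (cons 1 p)"
      by (simp add: f_def algebra_simps)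
  qed
  also have "\<dots> = sum f (cons 0 ` T') + sum f (cons 1 ` T')"
    using inj by (simp add: sum.distrib sum.reindex)
  also have "\<dots> = sum f (cons 0 ` T' \<union> cons 1 ` T')"
    using T'(1) by (intro sum.union_disjoint[symmetric]) (auto simp: cons_eq_iff)
  finally have "(\<Sum>r\<in>T. w r * cmod ((wop t ^^ Suc n) a r)) \<le> sum f (cons 0 ` T' \<union> cons 1 ` T')"
    using T'(2) unfolding v_def[symmetric] funpow_Suc_right o_def by linarith
  moreover have "f p = w ((shift ^^ Suc n) p) * H (Suc n) t p * cmod (a p)" for p
    by (simp add: f_def v_def H_Suc funpow_swap1)
  ultimately show ?case using T'(1)
    by (intro exI[of _ "cons 0 ` T' \<union> cons 1 ` T'"]) auto
qed

context beta_expansion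
begin

lemma cons_Q_imp: "cons d r \<in> Q \<Longrightarrow> r \<in> Q"
  using shift_Q[of "cons d r"] by simp

text \<open>Only indices in \<open>Q\<close>, hence in \<open>X\<close>, carry mass, so the supremum
  of \<open>H n t\<close> over the shift bounds the norm of the \<open>n\<close>-th power. This is
  how the growth rate enters.\<close>

lemma wop_pow_ell:
  assumes a: "a \<in> ell" and M: "\<And>p. p \<in> X \<Longrightarrow> H n t p \<le> M"
  shows "(wop t ^^ n) a \<in> ell" "l1norm ((wop t ^^ n) a) \<le> M * l1norm a"
proof -
  have M0: "0 \<le> M" using M[OF zero_in_X] by (simp add: H_def zero_digits_def)
  have bound: "(\<Sum>r\<in>T. cmod ((wop t ^^ n) a r)) \<le> M * l1norm a" if T: "finite T" for T
  proof -
    obtain T' where T': "finite T'" "(\<Sum>r\<in>T. cmod ((wop t ^^ n) a r)) \<le> (\<Sum>p\<in>T'. H n t p * cmod (a p))"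
      using wop_weighted_sum[where w = "\<lambda>_. 1" and T = T and t = t and n = n and a = a] T by auto
    note T'(2)
    also have "(\<Sum>p\<in>T'. H n t p * cmod (a p)) \<le> (\<Sum>p\<in>T'. M * cmod (a p))"
    proof (rule sum_mono)
      fix p
      show "H n t p * cmod (a p) \<le> M * cmod (a p)"
      proof (cases "p \<in> Q")
        case True
        then show ?thesis using M Q_subset by (intro mult_right_mono) auto
      next
        case False
        then show ?thesis using a by (simp add: ell_def)
      qed
    qed
    also have "\<dots> = M * (\<Sum>p\<in>T'. cmod (a p))" by (simp add: sum_distrib_left)
    also have "\<dots> \<le> M * l1norm a"
      using M0 sum_le_l1norm[OF ell_l1[OF a] T'(1)] by (intro mult_left_mono)
    finally show ?thesis .
  qed
  show "l1norm ((wop t ^^ n) a) \<le> M * l1norm a" using l1_bounded_sums(2)[OF bound] by blast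
  have "(wop t ^^ k) a r = 0" if "r \<notin> Q" for k r
    using that
  proof (induction k arbitrary: r)
    case (Suc k)
    then have "cons 0 r \<notin> Q" "cons 1 r \<notin> Q" using cons_Q_imp by blast+
    then show ?case using Suc.IH by (simp add: wop_def)
  qed (use a in \<open>simp add: ell_def\<close>)
  then show "(wop t ^^ n) a \<in> ell" using l1_bounded_sums(1)[OF bound] by (simp add: ell_def)
qed

lemma H_1_le: "p \<in> X \<Longrightarrow> H 1 t p \<le> exp \<bar>t\<bar>"
  using X_digit[of p 0] by (auto simp: H_def)

lemma wop_ell: "a \<in> ell \<Longrightarrow> wop t a \<in> ell"
  using wop_pow_ell(1)[of a 1, OF _ H_1_le] by simp

lemma lop_ell: "a \<in> ell \<Longrightarrow> lop t q a \<in> ell"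
  unfolding lop_def using wop_ell ell_add ell_scale single_ell q_in_Q by simp

text \<open>Above \<open>0x\<close> lie all sequences beginning with a positive digit and the
  \<open>0r\<close> with \<open>r\<close> at least \<open>x\<close>; the former contribute the
  constant \<open>lead a\<close>. Above \<open>1x\<close> only the \<open>1r\<close> with
  \<open>r\<close> at least \<open>x\<close> carry mass.\<close>

lemma transfer_fun_stepf:
  assumes a: "a \<in> ell"
  shows "transfer_fun \<beta> t (stepf a) = stepf (lop t q a)"
proof
  fix x
  have eq: "transfer_fun \<beta> t (stepf a) x = stepf a (cons 0 x) + of_real (exp t) * stepf a (cons 1 x)"
    by (rule transfer_fun_eq) (simp add: stepf_def)
  show "transfer_fun \<beta> t (stepf a) x = stepf (lop t q a) x"
  proof (cases "x \<in> X")
    case False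
    then have "cons 0 x \<notin> X" "cons 1 x \<notin> X" using shift_X[of "cons 0 x"] shift_X[of "cons 1 x"] by auto
    then show ?thesis using False unfolding eq by (simp add: stepf_def)
  next
    case True
    define R where "R = {r. lex_le x r}"
    have inj: "inj_on (cons d) R" for d by (metis cons_simps(3) inj_onI)
    have al1: "a \<in> l1" using a ell_l1 by blast
    have sum: "(\<lambda>r. a (cons d r)) summable_on R" for d
      using summable_on_reindex[OF inj, of a d] l1_summable_on[OF al1] by (simp add: o_def)
    have "{p. lex_le (cons 0 x) p} = cons 0 ` R \<union> {p. 0 < p 0}"
    proof (intro set_eqI iffI)
      fix p assume "p \<in> {p. lex_le (cons 0 x) p}"
      then have "0 < p 0 \<or> (p 0 = 0 \<and> lex_le x (shift p))" using lex_le_iff_shift[of "cons 0 x" p] by simp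
      then show "p \<in> cons 0 ` R \<union> {p. 0 < p 0}"
        using cons_shift[of p] by (auto simp: R_def intro!: image_eqI[of _ _ "shift p"])
    next
      fix p assume "p \<in> cons 0 ` R \<union> {p. 0 < p 0}"
      then show "p \<in> {p. lex_le (cons 0 x) p}" using lex_le_iff_shift[of "cons 0 x" p] by (auto simp: R_def)
    qed
    moreover have "infsum a (cons 0 ` R \<union> {p. 0 < p 0}) = infsum a (cons 0 ` R) + infsum a {p. 0 < p 0}"
      using l1_summable_on[OF al1] by (intro infsum_Un_disjoint) auto
    ultimately have 0: "stepf a (cons 0 x) = infsum (\<lambda>r. a (cons 0 r)) R + lead a"
      using True cons0_X[of x] infsum_reindex[OF inj, of a 0] by (simp add: stepf_def lead_def o_def)
    have 1: "stepf a (cons 1 x) = infsum (\<lambda>r. a (cons 1 r)) R"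
    proof (cases "cons 1 x \<in> X")
      case in_X: True
      \<comment> \<open>Digits are arbitrary natural numbers, so larger leading digits have to be
        ruled out through the support of \<open>a\<close>.\<close>
      have z: "a p = 0" if "1 < p 0" for p
      proof -
        have "p \<notin> X" using X_digit[of p 0] that by auto
        then show ?thesis using a Q_subset by (auto simp: ell_def)
      qed
      have "infsum a {p. lex_le (cons 1 x) p} = infsum a (cons 1 ` R)"
      proof (rule infsum_cong_neutral)
        fix p assume p: "p \<in> {p. lex_le (cons 1 x) p} - cons 1 ` R"
        then have "1 < p 0 \<or> (p 0 = 1 \<and> lex_le x (shift p))"
          using lex_le_iff_shift[of "cons 1 x" p] by auto
        then show "a p = 0" using z p cons_shift[of p] by (auto simp: R_def image_iff)
      next
        fix p assume p: "p \<in> cons 1 ` R - {p. lex_le (cons 1 x) p}"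
        then show "a p = 0" using lex_le_iff_shift[of "cons 1 x" p] by (auto simp: R_def)
      qed simp
      then show ?thesis using in_X infsum_reindex[OF inj, of a 1] by (simp add: stepf_def o_def)
    next
      case not_X: False
      \<comment> \<open>When the 1-branch is cut off at \<open>x\<close>, it is cut off at every
        larger \<open>r\<close> too, so \<open>a\<close> has no jumps there.\<close>
      have "a (cons 1 r) = 0" if "r \<in> R" for r
      proof -
        have "cons 1 r \<notin> X"
        proof
          assume "cons 1 r \<in> X"
          then have "lex_le r (shift q)" using cons1_X by blast
          then have "lex_le x (shift q)" using that lex.order_trans unfolding R_def by blast
          then show False using not_X True cons1_X by blast
        qed
        then show ?thesis using a Q_subset by (auto simp: ell_def)
      qed
      then have "infsum (\<lambda>r. a (cons 1 r)) R = infsum (\<lambda>_. 0) R" by (intro infsum_cong)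
      then show ?thesis using not_X by (simp add: stepf_def)
    qed
    have "stepf (lop t q a) x = infsum (\<lambda>r. (a (cons 0 r) + of_real (exp t) * a (cons 1 r)) + lead a * single q r) R"
      using True by (simp add: stepf_def lop_def wop_def R_def)
    also have "\<dots> = infsum (\<lambda>r. a (cons 0 r) + of_real (exp t) * a (cons 1 r)) R
        + infsum (\<lambda>r. lead a * single q r) R"
      using sum l1_summable_on[OF single_l1(1)]
      by (intro infsum_add summable_on_add summable_on_cmult_right) auto
    also have "infsum (\<lambda>r. a (cons 0 r) + of_real (exp t) * a (cons 1 r)) R =
        infsum (\<lambda>r. a (cons 0 r)) R + infsum (\<lambda>r. of_real (exp t) * a (cons 1 r)) R"
      using sum by (intro infsum_add summable_on_cmult_right) auto
    \<comment> \<open>Every \<open>x\<close> in \<open>X\<close> lies below \<open>q\<close>, so a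
      jump at \<open>q\<close> represents a constant.\<close>
    also have "infsum (\<lambda>r. lead a * single q r) R = lead a"
      using X_le[OF True] by (simp add: infsum_cmult_right' single_l1(2) R_def)
    finally show ?thesis unfolding eq 0 1 by (simp add: infsum_cmult_right')
  qed
qed

lemma op_minus_stepf:
  assumes a: "a \<in> ell"
  shows "op_minus \<beta> t \<mu> (cls \<beta> (stepf a)) = cls \<beta> (stepf (\<lambda>p. lop t q a p - \<mu> * a p))"
    and "transfer_op \<beta> t (cls \<beta> (stepf a)) = cls \<beta> (stepf (lop t q a))"
    and "scale_cls \<beta> \<mu> (cls \<beta> (stepf a)) = cls \<beta> (stepf (\<lambda>p. \<mu> * a p))"
proof -
  note BVs = stepf_BV(1)[OF ell_l1]
  show tr: "transfer_op \<beta> t (cls \<beta> (stepf a)) = cls \<beta> (stepf (lop t q a))"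
    using transfer_op_eq[of "stepf a" t] BVs[OF a] BVs[OF lop_ell[OF a]] by (simp add: transfer_fun_stepf[OF a])
  show sc: "scale_cls \<beta> \<mu> (cls \<beta> (stepf a)) = cls \<beta> (stepf (\<lambda>p. \<mu> * a p))"
    using scale_cls_eq[of "stepf a" \<mu>] BVs[OF a] BVs[OF ell_scale[OF a, of \<mu>]] by (simp add: stepf_scale)
  show "op_minus \<beta> t \<mu> (cls \<beta> (stepf a)) = cls \<beta> (stepf (\<lambda>p. lop t q a p - \<mu> * a p))"
    unfolding op_minus_def tr sc
    using diff_cls_eq[OF BVs[OF lop_ell[OF a]] BVs[OF ell_scale[OF a]]]
      stepf_diff[OF ell_l1[OF lop_ell[OF a]] ell_l1[OF ell_scale[OF a]]] by simp
qed

lemma wop_pow_single: "(wop t ^^ k) (single q) = (\<lambda>p. of_real (H k t q) * single ((shift ^^ k) q) p)"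
proof (induction k)
  case (Suc k)
  have "(shift ^^ k) q 0 = 0 \<or> (shift ^^ k) q 0 = 1" using quasi_one_digit[of k] by simp
  note step = wop_single[of "(shift ^^ k) q" t, OF this]
  have H: "H (Suc k) t q = H k t q * exp (t * real ((shift ^^ k) q 0))"
    by (simp add: H_def distrib_left exp_add)
  have "(wop t ^^ Suc k) (single q) = wop t (\<lambda>p. of_real (H k t q) * single ((shift ^^ k) q) p)"
    unfolding funpow.simps o_def Suc ..
  also have "\<dots> = (\<lambda>p. of_real (H (Suc k) t q) * single ((shift ^^ Suc k) q) p)"
    unfolding step H funpow.simps o_def of_real_mult ..
  finally show ?case .
qed (simp add: H_def)

text \<open>\<open>lead\<close> reads the first digit of the \<open>k\<close>-th shift of
  \<open>q\<close>, that is \<open>q k\<close>. The result is the coefficient of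
  \<open>z ^ Suc k\<close> in \<open>phi\<close>.\<close>

lemma lead_wop_pow_single: "lead ((wop t ^^ k) (single q)) = of_nat (q k) * of_real (H k t q)"
  using quasi_one_digit[of k]
  by (auto simp: wop_pow_single lead_scale) (auto simp: lead_def single_l1(2))

end

text \<open>Replaces the limsup in the growth rate by a geometric bound for all \<open>n\<close>;
  \<open>growth_bound\<close> supplies a \<open>\<rho>\<close> between the growth rate and
  \<open>cmod \<mu>\<close>.\<close>

locale bounded_growth = beta_expansion +
  fixes t \<rho> C :: real
  assumes growth: "\<And>n p. p \<in> beta_shift \<beta> \<Longrightarrow> H n t p \<le> C * \<rho> ^ n" and rho_pos: "0 < \<rho>"
begin

lemma wop_pow_bound: "a \<in> ell \<Longrightarrow> l1norm ((wop t ^^ n) a) \<le> C * \<rho> ^ n * l1norm a"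
  by (rule wop_pow_ell(2)[OF _ growth])

lemma wop_pow_in_ell: "a \<in> ell \<Longrightarrow> (wop t ^^ n) a \<in> ell"
  by (rule wop_pow_ell(1)[OF _ growth])

lemma C_nonneg: "0 \<le> C"
  using growth[OF zero_in_X, of 0] by (simp add: H_def)

section \<open>The resolvent of the jump operator by its Neumann series\<close>

context
  fixes \<mu> :: complex
  assumes mu: "\<rho> < cmod \<mu>"
begin

lemma mu_nz: "\<mu> \<noteq> 0"
  using mu rho_pos by auto

lemma ratio_less: "\<rho> / cmod \<mu> < 1"
  using mu rho_pos by (subst divide_less_eq_1_pos) linarith+

text \<open>Bounds the norm of the \<open>k\<close>-th Neumann term; one factor
  \<open>1 / cmod \<mu>\<close> stands apart because that term carries
  \<open>inverse \<mu> ^ Suc k\<close>.\<close>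

definition "rcoeff k = C / cmod \<mu> * (\<rho> / cmod \<mu>) ^ k"

definition "rbound = suminf rcoeff"

lemma rcoeff_nonneg: "0 \<le> rcoeff k"
  unfolding rcoeff_def using C_nonneg rho_pos by simp

lemma rcoeff_summable: "summable rcoeff"
  unfolding rcoeff_def using ratio_less rho_pos by (intro summable_mult summable_geometric) auto

lemma ratio_tendsto: "(\<lambda>n. (\<rho> / cmod \<mu>) ^ n * c) \<longlonglongrightarrow> 0"
  using ratio_less rho_pos by (intro tendsto_mult_left_zero LIMSEQ_power_zero) auto

lemma neumann_term:
  assumes "a \<in> ell"
  shows "l1norm (\<lambda>p. inverse \<mu> ^ Suc k * (wop t ^^ k) a p) \<le> rcoeff k * l1norm a"
proof -
  have "l1norm (\<lambda>p. inverse \<mu> ^ Suc k * (wop t ^^ k) a p) = inverse (cmod \<mu>) ^ Suc k * l1norm ((wop t ^^ k) a)"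
    using l1_scale(2)[OF ell_l1[OF wop_pow_in_ell[OF assms]]] by (simp add: norm_power norm_inverse norm_mult)
  also have "\<dots> \<le> inverse (cmod \<mu>) ^ Suc k * (C * \<rho> ^ k * l1norm a)"
    using wop_pow_bound[OF assms] by (intro mult_left_mono) auto
  also have "\<dots> = rcoeff k * l1norm a" by (simp add: rcoeff_def field_simps)
  finally show ?thesis .
qed

lemma neumann_diff_bound:
  assumes a: "a \<in> ell"
  shows "(\<lambda>p. neumann t \<mu> (m + j) a p - neumann t \<mu> m a p) \<in> ell \<and>
    l1norm (\<lambda>p. neumann t \<mu> (m + j) a p - neumann t \<mu> m a p) \<le> (\<Sum>k\<in>{m..<m+j}. rcoeff k) * l1norm a"
proof (induction j)
  case 0
  then show ?case by (simp add: ell_0)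
next
  case (Suc j)
  define d where "d = (\<lambda>p. neumann t \<mu> (m + j) a p - neumann t \<mu> m a p)"
  define e where "e = (\<lambda>p. inverse \<mu> ^ Suc (m + j) * (wop t ^^ (m + j)) a p)"
  have eq: "(\<lambda>p. neumann t \<mu> (m + Suc j) a p - neumann t \<mu> m a p) = (\<lambda>p. d p + e p)"
    by (simp add: neumann_def d_def e_def algebra_simps)
  have e: "e \<in> ell" unfolding e_def using a wop_pow_in_ell ell_scale by blast
  have d: "d \<in> ell" "l1norm d \<le> (\<Sum>k\<in>{m..<m+j}. rcoeff k) * l1norm a" using Suc by (auto simp: d_def)
  have "l1norm (\<lambda>p. d p + e p) \<le> l1norm d + l1norm e" using l1_add(2) ell_l1 d e by blast
  also have "\<dots> \<le> (\<Sum>k\<in>{m..<m+j}. rcoeff k) * l1norm a + rcoeff (m + j) * l1norm a"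
    using d(2) neumann_term[OF a, of "m + j"] unfolding e_def by linarith
  finally show ?case unfolding eq using ell_add[OF d(1) e] by (simp add: distrib_right)
qed

lemma neumann_bound:
  assumes a: "a \<in> ell"
  shows "neumann t \<mu> n a \<in> ell" "l1norm (neumann t \<mu> n a) \<le> rbound * l1norm a"
proof -
  have 0: "neumann t \<mu> 0 a p = 0" for p by (simp add: neumann_def)
  have *: "neumann t \<mu> n a \<in> ell \<and> l1norm (neumann t \<mu> n a) \<le> (\<Sum>k\<in>{0..<n}. rcoeff k) * l1norm a"
    using neumann_diff_bound[OF a, of 0 n] by (simp add: 0)
  then show "neumann t \<mu> n a \<in> ell" by blast
  have "(\<Sum>k\<in>{0..<n}. rcoeff k) \<le> rbound"
    unfolding rbound_def using rcoeff_summable rcoeff_nonneg by (intro sum_le_suminf) auto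
  from mult_right_mono[OF this l1norm_nonneg[of a]] *
  show "l1norm (neumann t \<mu> n a) \<le> rbound * l1norm a" by linarith
qed

lemma remainder_bound:
  assumes "a \<in> ell"
  shows "l1norm (\<lambda>p. inverse \<mu> ^ n * (wop t ^^ n) a p) \<le> (\<rho> / cmod \<mu>) ^ n * (C * l1norm a)"
proof -
  have "l1norm (\<lambda>p. inverse \<mu> ^ n * (wop t ^^ n) a p) = inverse (cmod \<mu>) ^ n * l1norm ((wop t ^^ n) a)"
    using l1_scale(2)[OF ell_l1[OF wop_pow_in_ell[OF assms]]] by (simp add: norm_power norm_inverse)
  also have "\<dots> \<le> inverse (cmod \<mu>) ^ n * (C * \<rho> ^ n * l1norm a)"
    using wop_pow_bound[OF assms] by (intro mult_left_mono) auto
  also have "\<dots> = (\<rho> / cmod \<mu>) ^ n * (C * l1norm a)" by (simp add: field_simps)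
  finally show ?thesis .
qed

lemma remainder_tendsto:
  assumes "a \<in> ell"
  shows "(\<lambda>n. l1norm (\<lambda>p. inverse \<mu> ^ n * (wop t ^^ n) a p)) \<longlonglongrightarrow> 0"
  by (rule tendsto_sandwich[OF _ _ tendsto_const ratio_tendsto])
    (auto intro!: always_eventually l1norm_nonneg remainder_bound[OF assms])

lemma remainder_tendsto_pointwise:
  assumes a: "a \<in> ell"
  shows "(\<lambda>n. inverse \<mu> ^ n * (wop t ^^ n) a p) \<longlonglongrightarrow> 0"
proof (rule Lim_null_comparison[OF _ remainder_tendsto[OF a]])
  have "(\<lambda>p. inverse \<mu> ^ n * (wop t ^^ n) a p) \<in> l1" for n
    using a wop_pow_in_ell ell_scale ell_l1 by blast
  from cmod_le_l1norm[OF this]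
  show "eventually (\<lambda>n. cmod (inverse \<mu> ^ n * (wop t ^^ n) a p)
      \<le> l1norm (\<lambda>p. inverse \<mu> ^ n * (wop t ^^ n) a p)) sequentially"
    by (intro always_eventually allI)
qed

text \<open>The Neumann sums are Cauchy in l1. Since \<open>wop\<close> reads only two coordinates
  for each index, pointwise convergence suffices to pass to the limit in
  \<open>neumann_identity\<close>.\<close>

lemma wop_resolvent_exists:
  assumes a: "a \<in> ell"
  obtains b where "b \<in> ell" "\<And>p. \<mu> * b p - wop t b p = a p"
proof -
  have na: "neumann t \<mu> n a \<in> l1" for n using neumann_bound(1)[OF a] ell_l1 by blast
  have cauchy: "\<exists>N. \<forall>m\<ge>N. \<forall>n\<ge>N. l1norm (\<lambda>p. neumann t \<mu> m a p - neumann t \<mu> n a p) < e"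
    if e: "e > 0" for e
  proof -
    \<comment> \<open>The added 1 avoids division by zero when \<open>a\<close> vanishes.\<close>
    define e' where "e' = e / (l1norm a + 1)"
    have pos: "0 < l1norm a + 1" using l1norm_nonneg[of a] by linarith
    then have "e' > 0" using e by (simp add: e'_def)
    then obtain N where N: "\<And>m n. m \<ge> N \<Longrightarrow> norm (sum rcoeff {m..<n}) < e'"
      using rcoeff_summable unfolding summable_Cauchy by blast
    have ord: "l1norm (\<lambda>p. neumann t \<mu> n a p - neumann t \<mu> m a p) < e" if "N \<le> m" "m \<le> n" for m n
    proof -
      have "l1norm (\<lambda>p. neumann t \<mu> n a p - neumann t \<mu> m a p) \<le> sum rcoeff {m..<n} * l1norm a"
        using neumann_diff_bound[OF a, of m "n - m"] that by simp
      also have "\<dots> \<le> e' * l1norm a"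
        using N[OF that(1), of n] l1norm_nonneg by (intro mult_right_mono) (auto simp: abs_le_iff)
      also have "\<dots> < e' * (l1norm a + 1)" using \<open>e' > 0\<close> by simp
      also have "\<dots> = e" using pos by (simp add: e'_def)
      finally show ?thesis .
    qed
    have "l1norm (\<lambda>p. neumann t \<mu> m a p - neumann t \<mu> n a p) < e" if "m \<ge> N" "n \<ge> N" for m n
    proof (cases "n \<le> m")
      case True
      then show ?thesis using ord that by blast
    next
      case False
      then show ?thesis using ord[of m n] that by (subst l1norm_minus_commute) simp
    qed
    then show ?thesis by blast
  qed
  obtain b where b: "b \<in> l1" "\<And>p. (\<lambda>n. neumann t \<mu> n a p) \<longlonglongrightarrow> b p"
    using l1_complete[of "\<lambda>n. neumann t \<mu> n a", OF na cauchy] by blast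
  have "b p = 0" if "p \<notin> Q" for p
  proof -
    have "(\<lambda>n. neumann t \<mu> n a p) = (\<lambda>_. 0)" using that neumann_bound(1)[OF a] by (auto simp: ell_def)
    with b(2)[of p] have "(\<lambda>_. 0) \<longlonglongrightarrow> b p" by simp
    then show ?thesis unfolding LIMSEQ_const_iff by simp
  qed
  then have "b \<in> ell" using b(1) by (simp add: ell_def)
  moreover have "\<mu> * b p - wop t b p = a p" for p
  proof (rule LIMSEQ_unique)
    show "(\<lambda>n. \<mu> * neumann t \<mu> n a p - wop t (neumann t \<mu> n a) p) \<longlonglongrightarrow> \<mu> * b p - wop t b p"
      unfolding wop_def by (intro tendsto_intros b)
    have "(\<lambda>n. a p - inverse \<mu> ^ n * (wop t ^^ n) a p) \<longlonglongrightarrow> a p - 0"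
      by (intro tendsto_intros remainder_tendsto_pointwise a)
    then show "(\<lambda>n. \<mu> * neumann t \<mu> n a p - wop t (neumann t \<mu> n a) p) \<longlonglongrightarrow> a p"
      by (simp add: neumann_identity[OF mu_nz])
  qed
  ultimately show ?thesis using that by blast
qed

lemma wop_resolvent_bound:
  assumes b: "b \<in> ell" and eq: "\<And>p. \<mu> * b p - wop t b p = a p"
  shows "l1norm b \<le> rbound * l1norm a"
proof (rule l1_bounded_sums(2))
  have a_eq: "a = (\<lambda>p. \<mu> * b p - wop t b p)" using eq by auto
  have a: "a \<in> ell" unfolding a_eq using b ell_diff ell_scale wop_ell by blast
  have lim: "(\<lambda>n. neumann t \<mu> n a p) \<longlonglongrightarrow> b p" for p
  proof -
    have "(\<lambda>n. b p - inverse \<mu> ^ n * (wop t ^^ n) b p) \<longlonglongrightarrow> b p - 0"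
      by (intro tendsto_intros remainder_tendsto_pointwise b)
    then show ?thesis unfolding a_eq by (simp add: neumann_resolvent[OF mu_nz])
  qed
  fix S :: "digits set" assume S: "finite S"
  show "(\<Sum>p\<in>S. cmod (b p)) \<le> rbound * l1norm a"
  proof (rule tendsto_upperbound)
    show "(\<lambda>n. \<Sum>p\<in>S. cmod (neumann t \<mu> n a p)) \<longlonglongrightarrow> (\<Sum>p\<in>S. cmod (b p))"
      by (intro tendsto_intros lim)
    show "eventually (\<lambda>n. (\<Sum>p\<in>S. cmod (neumann t \<mu> n a p)) \<le> rbound * l1norm a) sequentially"
      using sum_le_l1norm[OF ell_l1[OF neumann_bound(1)[OF a]] S] neumann_bound(2)[OF a]
      by (intro always_eventually allI) (meson order_trans)
  qed simp
qed

lemma lead_neumann_single: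
  "lead (neumann t \<mu> n (single q)) =
    (\<Sum>k<n. of_nat (q k) * of_real (H k t q) * inverse \<mu> ^ Suc k)"
proof (induction n)
  case 0
  then show ?case by (simp add: neumann_def lead_def)
next
  case (Suc n)
  have s: "single q \<in> ell" using single_ell q_in_Q by blast
  define e where "e = (\<lambda>p. - (inverse \<mu> ^ Suc n) * (wop t ^^ n) (single q) p)"
  have e: "e \<in> ell" unfolding e_def using s wop_pow_in_ell ell_scale by blast
  have "neumann t \<mu> (Suc n) (single q) = (\<lambda>p. neumann t \<mu> n (single q) p - e p)"
    by (simp add: neumann_def e_def)
  then have "lead (neumann t \<mu> (Suc n) (single q)) = lead (neumann t \<mu> n (single q)) - lead e"
    using lead_diff ell_l1 neumann_bound(1)[OF s] e by simp
  then show ?case unfolding Suc e_def lead_scale lead_wop_pow_single by simp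
qed

text \<open>The Neumann sums of \<open>single q\<close> miss \<open>u\<close> by the remainder,
  which tends to 0 in l1. The bounded functional \<open>lead\<close> carries this over to the
  partial sums of \<open>phi\<close>, so their convergence is obtained as well.\<close>

lemma phi_eq_lead:
  assumes u: "u \<in> ell" "\<And>p. \<mu> * u p - wop t u p = single q p"
  shows "phi \<beta> t (inverse \<mu>) = lead u"
proof -
  have s: "single q = (\<lambda>p. \<mu> * u p - wop t u p)" using u(2) by auto
  have s_ell: "single q \<in> ell" using single_ell q_in_Q by blast
  have "(\<lambda>n. lead (neumann t \<mu> n (single q)) - lead u) \<longlonglongrightarrow> 0"
  proof (rule Lim_null_comparison[OF _ remainder_tendsto[OF u(1)]])
    have "cmod (lead (neumann t \<mu> n (single q)) - lead u) \<le> l1norm (\<lambda>p. inverse \<mu> ^ n * (wop t ^^ n) u p)" for n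
    proof -
      have "lead (neumann t \<mu> n (single q)) - lead u = lead (\<lambda>p. neumann t \<mu> n (single q) p - u p)"
        using lead_diff ell_l1 neumann_bound(1)[OF s_ell] u(1) by simp
      also have "(\<lambda>p. neumann t \<mu> n (single q) p - u p) = (\<lambda>p. - 1 * (inverse \<mu> ^ n * (wop t ^^ n) u p))"
        unfolding s by (simp add: neumann_resolvent[OF mu_nz])
      finally show ?thesis
        using lead_bound[OF ell_l1[OF ell_scale[OF wop_pow_in_ell[OF u(1)]]]] by (simp only: lead_scale norm_mult) simp
    qed
    then show "eventually (\<lambda>n. cmod (lead (neumann t \<mu> n (single q)) - lead u)
        \<le> l1norm (\<lambda>p. inverse \<mu> ^ n * (wop t ^^ n) u p)) sequentially"
      by (intro always_eventually allI)
  qed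
  then have "(\<lambda>n. lead (neumann t \<mu> n (single q))) \<longlonglongrightarrow> lead u" by (simp add: LIM_zero_iff)
  then have "(\<lambda>k. of_nat (q k) * of_real (H k t q) * inverse \<mu> ^ Suc k) sums lead u"
    unfolding sums_def lead_neumann_single .
  then show ?thesis unfolding phi_def by (rule sums_unique[symmetric])
qed

end

end

section \<open>Eigenvalues and spectrum\<close>

context beta_expansion
begin

lemma l1norm_le_0:
  assumes "a \<in> l1" "l1norm a \<le> 0"
  shows "a = (\<lambda>_. 0)"
proof
  fix p
  have "cmod (a p) \<le> 0" using cmod_le_l1norm[OF assms(1), of p] assms(2) by linarith
  then show "a p = 0" by simp
qed

lemma cls_stepf_inj:
  assumes a: "a \<in> ell" and b: "b \<in> ell" and eq: "cls \<beta> (stepf a) = cls \<beta> (stepf b)"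
  shows "a = b"
proof -
  note BVs = stepf_BV(1)[OF ell_l1]
  define d where "d = (\<lambda>p. a p - b p)"
  have d: "d \<in> ell" unfolding d_def using a b by (rule ell_diff)
  have "co_eq \<beta> (stepf a) (stepf b)" using eq BVs[OF a] BVs[OF b] by (simp add: cls_eq_iff)
  then have "co_eq \<beta> (stepf d) (stepf (\<lambda>_. 0))"
    unfolding d_def stepf_diff[OF ell_l1[OF a] ell_l1[OF b]] stepf_0 by (simp add: co_eq_def)
  then have "cls \<beta> (stepf d) = cls \<beta> (stepf (\<lambda>_. 0))"
    using BVs[OF d] BVs[OF ell_0] by (simp add: cls_eq_iff)
  then have "l1norm d \<le> 0"
    using quot_norm_stepf_ge[OF d] quot_norm_stepf_le[OF zero_in_l1] by simp
  then have "d = (\<lambda>_. 0)" using l1norm_le_0 ell_l1 d by blast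
  then show ?thesis unfolding d_def fun_eq_iff by simp
qed

lemma zero_cls_eq: "zero_cls \<beta> = cls \<beta> (stepf (\<lambda>_. 0))"
  by (simp add: zero_cls_def stepf_0)

lemma eigenvalue_iff:
  "op_eigenvalue \<beta> t \<mu> \<longleftrightarrow> (\<exists>a\<in>ell. a \<noteq> (\<lambda>_. 0) \<and> lop t q a = (\<lambda>p. \<mu> * a p))"
proof
  assume "op_eigenvalue \<beta> t \<mu>"
  then obtain a where a: "a \<in> ell" "cls \<beta> (stepf a) \<noteq> zero_cls \<beta>"
    "transfer_op \<beta> t (cls \<beta> (stepf a)) = scale_cls \<beta> \<mu> (cls \<beta> (stepf a))"
    unfolding op_eigenvalue_def F_space_eq by blast
  then have "lop t q a = (\<lambda>p. \<mu> * a p)"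
    using cls_stepf_inj[OF lop_ell[OF a(1)] ell_scale[OF a(1)]] by (simp add: op_minus_stepf(2,3))
  moreover have "a \<noteq> (\<lambda>_. 0)" using a(2) zero_cls_eq by auto
  ultimately show "\<exists>a\<in>ell. a \<noteq> (\<lambda>_. 0) \<and> lop t q a = (\<lambda>p. \<mu> * a p)" using a(1) by blast
next
  assume "\<exists>a\<in>ell. a \<noteq> (\<lambda>_. 0) \<and> lop t q a = (\<lambda>p. \<mu> * a p)"
  then obtain a where a: "a \<in> ell" "a \<noteq> (\<lambda>_. 0)" "lop t q a = (\<lambda>p. \<mu> * a p)" by blast
  have "cls \<beta> (stepf a) \<in> F_space \<beta>" using a unfolding F_space_eq by blast
  moreover have "cls \<beta> (stepf a) \<noteq> zero_cls \<beta>"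
    using cls_stepf_inj[OF a(1) ell_0] a(2) unfolding zero_cls_eq by blast
  moreover have "transfer_op \<beta> t (cls \<beta> (stepf a)) = scale_cls \<beta> \<mu> (cls \<beta> (stepf a))"
    using a by (simp add: op_minus_stepf(2,3))
  ultimately show "op_eigenvalue \<beta> t \<mu>" unfolding op_eigenvalue_def by blast
qed

lemma eigenvalue_in_spectrum:
  assumes "op_eigenvalue \<beta> t \<mu>"
  shows "\<mu> \<in> op_spectrum \<beta> t"
proof -
  obtain a where a: "a \<in> ell" "a \<noteq> (\<lambda>_. 0)" "lop t q a = (\<lambda>p. \<mu> * a p)"
    using assms eigenvalue_iff by blast
  have "op_minus \<beta> t \<mu> (cls \<beta> (stepf a)) = op_minus \<beta> t \<mu> (cls \<beta> (stepf (\<lambda>_. 0)))"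
    unfolding op_minus_stepf(1)[OF a(1)] op_minus_stepf(1)[OF ell_0]
    by (simp add: a(3)) (simp add: lop_def wop_def lead_def)
  moreover have "cls \<beta> (stepf a) \<noteq> cls \<beta> (stepf (\<lambda>_. 0))" using cls_stepf_inj[OF a(1) ell_0] a(2) by blast
  moreover have "cls \<beta> (stepf a) \<in> F_space \<beta>" "cls \<beta> (stepf (\<lambda>_. 0)) \<in> F_space \<beta>"
    unfolding F_space_eq using a(1) ell_0 by blast+
  ultimately have "\<not> inj_on (op_minus \<beta> t \<mu>) (F_space \<beta>)" unfolding inj_on_def by blast
  then show ?thesis unfolding op_spectrum_def bij_betw_def by blast
qed

lemma wop_combine:
  "wop t (\<lambda>p. a p + s * b p) p = wop t a p + s * wop t b p"
  by (simp add: wop_def algebra_simps)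

lemma lead_combine: "a \<in> ell \<Longrightarrow> b \<in> ell \<Longrightarrow> lead (\<lambda>p. a p + s * b p) = lead a + s * lead b"
  using lead_diff[of a "\<lambda>p. - s * b p"] ell_l1 ell_scale[of b "- s"] lead_scale[of "- s" b] by simp

end

section \<open>The rank-one perturbation and the zeros of the power series\<close>

context bounded_growth
begin

context
  fixes \<mu> :: complex
  assumes mu: "\<rho> < cmod \<mu>"
begin

text \<open>The solution \<open>u\<close> of \<open>(\<mu> - W) u = e_q\<close> is itself an
  eigenvector once \<open>lead u = 1\<close>, because then
  \<open>\<mu> u = W u + lead u * e_q\<close>.\<close>

lemma eigenvalue_if_phi:
  assumes "phi \<beta> t (inverse \<mu>) = 1"
  shows "op_eigenvalue \<beta> t \<mu>"
proof -
  obtain u where u: "u \<in> ell" "\<And>p. \<mu> * u p - wop t u p = single q p"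
    using wop_resolvent_exists[OF mu single_ell[OF q_in_Q]] by blast
  have "lead u = 1" using phi_eq_lead[OF mu u] assms by simp
  then have "lop t q u = (\<lambda>p. \<mu> * u p)" using u(2) by (auto simp: lop_def algebra_simps)
  moreover have "u \<noteq> (\<lambda>_. 0)"
  proof
    assume "u = (\<lambda>_. 0)"
    then show False using u(2)[of q] by (simp add: single_def wop_def)
  qed
  ultimately show ?thesis using u(1) eigenvalue_iff by blast
qed

text \<open>With \<open>s = lead a\<close>, the family \<open>v = a - s u\<close> solves
  \<open>(\<mu> - W) v = - c\<close>, so \<open>v\<close> is bounded by \<open>c\<close>. Since
  \<open>lead v = s (1 - lead u)\<close> and the last factor is nonzero, \<open>s\<close> and then
  \<open>a = v + s u\<close> are bounded too.\<close>

lemma lop_minus_bound: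
  assumes phi: "phi \<beta> t (inverse \<mu>) \<noteq> 1"
  obtains K where "0 \<le> K" "\<And>a. a \<in> ell \<Longrightarrow> l1norm a \<le> K * l1norm (\<lambda>p. lop t q a p - \<mu> * a p)"
proof -
  obtain u where u: "u \<in> ell" "\<And>p. \<mu> * u p - wop t u p = single q p"
    using wop_resolvent_exists[OF mu single_ell[OF q_in_Q]] by blast
  define \<delta> where "\<delta> = cmod (1 - lead u)"
  have "0 < \<delta>" using phi phi_eq_lead[OF mu u] by (simp add: \<delta>_def)
  define K where "K = (1 + l1norm u / \<delta>) * rbound \<mu>"
  have f0: "0 \<le> 1 + l1norm u / \<delta>" using \<open>0 < \<delta>\<close> l1norm_nonneg[of u] by simp
  have "l1norm a \<le> K * l1norm (\<lambda>p. lop t q a p - \<mu> * a p)" if a: "a \<in> ell" for a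
  proof -
    define c where "c = (\<lambda>p. lop t q a p - \<mu> * a p)"
    define s where "s = lead a"
    define v where "v = (\<lambda>p. a p + (- s) * u p)"
    have v: "v \<in> ell" unfolding v_def using a u(1) by (intro ell_add ell_scale)
    have "\<mu> * v p - wop t v p = - 1 * c p" for p
    proof -
      have "\<mu> * v p - wop t v p = (\<mu> * a p - wop t a p) - s * (\<mu> * u p - wop t u p)"
        unfolding v_def wop_combine by (simp add: algebra_simps)
      then show ?thesis unfolding u(2) c_def lop_def s_def by simp
    qed
    from wop_resolvent_bound[OF mu v this]
    have vb: "l1norm v \<le> rbound \<mu> * l1norm c"
      using l1_scale(2)[of c "- 1"] ell_l1[OF ell_diff[OF lop_ell[OF a, of t] ell_scale[OF a, of \<mu>]]]
      by (simp add: c_def)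
    have "lead v = s * (1 - lead u)"
      unfolding v_def lead_combine[OF a u(1)] by (simp add: s_def algebra_simps)
    then have "cmod s * \<delta> \<le> l1norm v"
      using lead_bound[OF ell_l1[OF v]] by (simp add: norm_mult \<delta>_def)
    then have s_le: "cmod s \<le> l1norm v / \<delta>" using \<open>0 < \<delta>\<close> by (simp add: field_simps)
    have "a = (\<lambda>p. v p + s * u p)" by (simp add: v_def)
    then have "l1norm a \<le> l1norm v + l1norm (\<lambda>p. s * u p)"
      using l1_add(2)[OF ell_l1[OF v] ell_l1[OF ell_scale[OF u(1), of s]]] by simp
    also have "l1norm (\<lambda>p. s * u p) = cmod s * l1norm u" using l1_scale(2) ell_l1 u(1) by blast
    also have "cmod s * l1norm u \<le> l1norm v / \<delta> * l1norm u"
      using s_le l1norm_nonneg by (intro mult_right_mono)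
    finally have "l1norm a \<le> (1 + l1norm u / \<delta>) * l1norm v" by (simp add: algebra_simps)
    also have "\<dots> \<le> (1 + l1norm u / \<delta>) * (rbound \<mu> * l1norm c)" using vb f0 by (rule mult_left_mono)
    finally show ?thesis by (simp add: K_def c_def mult.assoc)
  qed
  moreover have "0 \<le> K"
  proof -
    have "0 \<le> rbound \<mu>"
      unfolding rbound_def[OF mu] by (intro suminf_nonneg rcoeff_summable[OF mu] rcoeff_nonneg[OF mu])
    then show ?thesis using f0 by (simp add: K_def)
  qed
  ultimately show ?thesis using that by blast
qed

text \<open>The ansatz \<open>b = r + s u\<close>, with \<open>r\<close> the solution of
  \<open>(\<mu> - W) r = - c\<close>, works precisely when
  \<open>s = lead b = lead r + s * lead u\<close>; this fixes \<open>s\<close>.\<close>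

lemma lop_minus_surj:
  assumes phi: "phi \<beta> t (inverse \<mu>) \<noteq> 1" and c: "c \<in> ell"
  obtains b where "b \<in> ell" "(\<lambda>p. lop t q b p - \<mu> * b p) = c"
proof -
  obtain u where u: "u \<in> ell" "\<And>p. \<mu> * u p - wop t u p = single q p"
    using wop_resolvent_exists[OF mu single_ell[OF q_in_Q]] by blast
  obtain r where r: "r \<in> ell" "\<And>p. \<mu> * r p - wop t r p = - 1 * c p"
    using wop_resolvent_exists[OF mu ell_scale[OF c]] by blast
  have nz: "1 - lead u \<noteq> 0" using phi phi_eq_lead[OF mu u] by simp
  define s where "s = lead r / (1 - lead u)"
  define b where "b = (\<lambda>p. r p + s * u p)"
  have b: "b \<in> ell" unfolding b_def using r(1) u(1) by (intro ell_add ell_scale)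
  have "lead r = s * (1 - lead u)" using nz by (simp add: s_def)
  then have "lead b = s" unfolding b_def lead_combine[OF r(1) u(1)] by (simp add: algebra_simps)
  have "lop t q b p - \<mu> * b p = c p" for p
  proof -
    have "lop t q b p - \<mu> * b p = s * single q p - (\<mu> * r p - wop t r p) - s * (\<mu> * u p - wop t u p)"
      unfolding lop_def \<open>lead b = s\<close> unfolding b_def wop_combine by (simp add: algebra_simps)
    then show ?thesis unfolding u(2) r(2) by simp
  qed
  then show ?thesis using that b by blast
qed

lemma not_in_spectrum:
  assumes phi: "phi \<beta> t (inverse \<mu>) \<noteq> 1"
  shows "\<mu> \<notin> op_spectrum \<beta> t"
proof -
  obtain K where K: "0 \<le> K" "\<And>a. a \<in> ell \<Longrightarrow> l1norm a \<le> K * l1norm (\<lambda>p. lop t q a p - \<mu> * a p)"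
    using lop_minus_bound[OF phi] by blast
  define T where "T a = (\<lambda>p. lop t q a p - \<mu> * a p)" for a
  have T_ell: "T a \<in> ell" if "a \<in> ell" for a
    unfolding T_def using that lop_ell ell_scale ell_diff by simp
  have op: "op_minus \<beta> t \<mu> (cls \<beta> (stepf a)) = cls \<beta> (stepf (T a))" if "a \<in> ell" for a
    using op_minus_stepf(1)[OF that] by (simp add: T_def)
  have T_inj: "a = b" if ab: "a \<in> ell" "b \<in> ell" "T a = T b" for a b
  proof -
    define d where "d = (\<lambda>p. a p - b p)"
    have d: "d \<in> ell" unfolding d_def using ab ell_diff by blast
    have "T d = (\<lambda>p. T a p - T b p)"
      unfolding T_def lop_def d_def lead_diff[OF ell_l1[OF ab(1)] ell_l1[OF ab(2)]]
      by (simp add: wop_def algebra_simps)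
    then have "T d = (\<lambda>_. 0)" using ab(3) by simp
    then have "l1norm d \<le> 0" using K(2)[OF d] unfolding T_def by simp
    then have "d = (\<lambda>_. 0)" using l1norm_le_0 ell_l1 d by blast
    then show ?thesis unfolding d_def fun_eq_iff by simp
  qed
  have "bij_betw (op_minus \<beta> t \<mu>) (F_space \<beta>) (F_space \<beta>)"
  proof (rule bij_betw_imageI)
    show "inj_on (op_minus \<beta> t \<mu>) (F_space \<beta>)"
    proof (rule inj_onI)
      fix A B assume "A \<in> F_space \<beta>" "B \<in> F_space \<beta>" and eq: "op_minus \<beta> t \<mu> A = op_minus \<beta> t \<mu> B"
      then obtain a b where ab: "a \<in> ell" "A = cls \<beta> (stepf a)" "b \<in> ell" "B = cls \<beta> (stepf b)"
        unfolding F_space_eq by blast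
      then have "T a = T b" using eq op cls_stepf_inj[OF T_ell T_ell] by metis
      then show "A = B" using T_inj ab by blast
    qed
    show "op_minus \<beta> t \<mu> ` F_space \<beta> = F_space \<beta>"
    proof (intro set_eqI iffI)
      fix B assume "B \<in> op_minus \<beta> t \<mu> ` F_space \<beta>"
      then show "B \<in> F_space \<beta>" unfolding F_space_eq using op T_ell by auto
    next
      fix B assume "B \<in> F_space \<beta>"
      then obtain c where c: "c \<in> ell" "B = cls \<beta> (stepf c)" unfolding F_space_eq by blast
      obtain b where b: "b \<in> ell" "T b = c" using lop_minus_surj[OF phi c(1)] unfolding T_def by blast
      then have "B = op_minus \<beta> t \<mu> (cls \<beta> (stepf b))" using op c by simp
      then show "B \<in> op_minus \<beta> t \<mu> ` F_space \<beta>" using b(1) unfolding F_space_eq by blast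
    qed
  qed
  \<comment> \<open>The constant doubles in passing from the l1 norm back to the quotient
    norm.\<close>
  moreover have "\<forall>A\<in>F_space \<beta>. quot_norm \<beta> A \<le> 2 * K * quot_norm \<beta> (op_minus \<beta> t \<mu> A)"
  proof
    fix A assume "A \<in> F_space \<beta>"
    then obtain a where a: "a \<in> ell" "A = cls \<beta> (stepf a)" unfolding F_space_eq by blast
    have "quot_norm \<beta> A \<le> 2 * l1norm a" using quot_norm_stepf_le ell_l1 a by simp
    also have "\<dots> \<le> 2 * (K * l1norm (T a))" using K(2)[OF a(1)] by (simp add: T_def)
    also have "\<dots> \<le> 2 * (K * quot_norm \<beta> (cls \<beta> (stepf (T a))))"
      using quot_norm_stepf_ge[OF T_ell[OF a(1)]] K(1) by (simp add: mult_left_mono)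
    finally show "quot_norm \<beta> A \<le> 2 * K * quot_norm \<beta> (op_minus \<beta> t \<mu> A)"
      using op[OF a(1)] a(2) by simp
  qed
  ultimately show ?thesis unfolding op_spectrum_def by blast
qed

end

text \<open>The exponents of \<open>phi\<close> start at 1, so it is \<open>w\<close> times an
  ordinary power series \<open>g\<close>, whose coefficients are at most
  \<open>C * \<rho> ^ n\<close> in modulus.\<close>

lemma phi_holomorphic: "phi \<beta> t holomorphic_on ball 0 (1 / \<rho>)"
proof -
  define c :: "nat \<Rightarrow> complex" where "c n = of_nat (q n) * of_real (H n t q)" for n
  define g where "g w = (\<Sum>n. c n * w ^ n)" for w
  have sm: "summable (\<lambda>n. c n * w ^ n)" if "w \<in> ball 0 (1 / \<rho>)" for w
  proof (rule summable_comparison_test')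
    have "\<rho> * cmod w < 1" using that rho_pos by (simp add: field_simps)
    then show "summable (\<lambda>n. C * (\<rho> * cmod w) ^ n)"
      using rho_pos by (intro summable_mult summable_geometric) auto
    fix n :: nat
    have "cmod (c n) \<le> C * \<rho> ^ n"
    proof -
      have "cmod (c n) = real (q n) * H n t q" by (simp add: c_def norm_mult H_def)
      also have "\<dots> \<le> 1 * H n t q" using quasi_one_digit[of n] by (intro mult_right_mono) (auto simp: H_def)
      finally show ?thesis using growth[OF q_in_X, of n] by simp
    qed
    from mult_right_mono[OF this, of "cmod w ^ n"]
    show "norm (c n * w ^ n) \<le> C * (\<rho> * cmod w) ^ n"
      by (simp add: norm_mult norm_power power_mult_distrib mult.assoc)
  qed
  have "g holomorphic_on ball 0 (1 / \<rho>)"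
    using sm by (intro power_series_holomorphic[of 0 _ c]) (simp add: g_def summable_sums)
  then have hol: "(\<lambda>w. w * g w) holomorphic_on ball 0 (1 / \<rho>)" by (intro holomorphic_intros)
  have "w * g w = phi \<beta> t w" if "w \<in> ball 0 (1 / \<rho>)" for w
    using suminf_mult[OF sm[OF that], of w] by (simp add: phi_def g_def c_def mult_ac)
  then show ?thesis by (rule holomorphic_transform[OF hol])
qed

text \<open>\<open>1 - phi\<close> is holomorphic and not identically zero, so its zero at
  \<open>inverse \<mu>\<close> is isolated. By continuity of inversion, every \<open>\<nu>\<close>
  near \<open>\<mu>\<close> other than \<open>\<mu>\<close> has modulus above \<open>\<rho>\<close>
  and is not the inverse of a zero; hence it lies outside the spectrum.\<close>

lemma isolated_if_phi:
  assumes mu: "\<rho> < cmod \<mu>" and phi: "phi \<beta> t (inverse \<mu>) = 1"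
  shows "isolated_eigenvalue \<beta> t \<mu>"
proof -
  have nz: "\<mu> \<noteq> 0" using mu rho_pos by auto
  have S: "inverse \<mu> \<in> ball 0 (1 / \<rho>)"
    using mu rho_pos by (simp add: norm_inverse) (simp add: inverse_eq_divide frac_less2)
  have hol: "(\<lambda>z. 1 - phi \<beta> t z) holomorphic_on ball 0 (1 / \<rho>)"
    by (intro holomorphic_intros phi_holomorphic)
  have root: "1 - phi \<beta> t (inverse \<mu>) = 0" using phi by simp
  have nz0: "1 - phi \<beta> t 0 \<noteq> 0" by (simp add: phi_def)
  have "0 \<in> ball (0::complex) (1 / \<rho>)" using rho_pos by simp
  then have "\<exists>r>0. \<forall>z\<in>ball (inverse \<mu>) r - {inverse \<mu>}. 1 - phi \<beta> t z \<noteq> 0"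
  proof (rule isolated_zeros[OF hol open_ball connected_ball S root _ nz0])
    fix r :: real
    assume "0 < r" "\<And>z. z \<in> ball (inverse \<mu>) r - {inverse \<mu>} \<Longrightarrow> 1 - phi \<beta> t z \<noteq> 0"
    then show ?thesis by (intro exI[of _ r] conjI ballI)
  qed
  then obtain r where r: "0 < r"
    "\<And>z. z \<in> ball (inverse \<mu>) r - {inverse \<mu>} \<Longrightarrow> 1 - phi \<beta> t z \<noteq> 0"
    by meson
  have "(inverse \<longlongrightarrow> inverse \<mu>) (nhds \<mu>)"
    using nz by (intro tendsto_inverse) (auto simp: filterlim_ident)
  then have "eventually (\<lambda>\<nu>. dist (inverse \<nu>) (inverse \<mu>) < r) (nhds \<mu>)"
    using r(1) by (rule tendstoD)
  moreover have "eventually (\<lambda>\<nu>. \<rho> < cmod \<nu>) (nhds \<mu>)"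
    using mu by (intro order_tendstoD(1)[of _ "cmod \<mu>"] tendsto_norm) (auto simp: filterlim_ident)
  ultimately have "eventually (\<lambda>\<nu>. dist (inverse \<nu>) (inverse \<mu>) < r \<and> \<rho> < cmod \<nu>) (nhds \<mu>)"
    by (rule eventually_conj)
  then obtain e where e: "0 < e"
    "\<And>\<nu>. dist \<nu> \<mu> < e \<Longrightarrow> dist (inverse \<nu>) (inverse \<mu>) < r \<and> \<rho> < cmod \<nu>"
    unfolding eventually_nhds_metric by blast
  have "\<nu> = \<mu>" if \<nu>: "\<nu> \<in> op_spectrum \<beta> t" "dist \<mu> \<nu> < e" for \<nu>
  proof (rule ccontr)
    assume "\<nu> \<noteq> \<mu>"
    have *: "dist (inverse \<nu>) (inverse \<mu>) < r" "\<rho> < cmod \<nu>"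
      using e(2)[of \<nu>] \<nu>(2) by (auto simp: dist_commute)
    have "inverse \<nu> \<noteq> inverse \<mu>" using \<open>\<nu> \<noteq> \<mu>\<close> by simp
    then have "phi \<beta> t (inverse \<nu>) \<noteq> 1" using r(2)[of "inverse \<nu>"] * by (auto simp: dist_commute)
    then show False using not_in_spectrum[OF *(2)] \<nu>(1) by blast
  qed
  moreover have "op_eigenvalue \<beta> t \<mu>" using eigenvalue_if_phi[OF mu phi] .
  ultimately show ?thesis
    using e(1) eigenvalue_in_spectrum unfolding isolated_eigenvalue_def isolated_in_dist_Ex_iff by blast
qed

end

section \<open>From the growth rate to a geometric bound\<close>

context beta_expansion
begin

lemma birkhoff_eq: "x \<in> X \<Longrightarrow> exp (t * birkhoff n (indicator (cyl1 \<beta>)) x) = H n t x"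
proof -
  assume x: "x \<in> X"
  have "indicator (cyl1 \<beta>) ((shift ^^ i) x) = real (x i)" for i
    using X_digit[OF x, of i] shift_pow_X[OF x, of i] by (auto simp: cyl1_def indicator_def)
  then show ?thesis by (simp add: birkhoff_def H_def)
qed

lemma H_le_exp: "x \<in> X \<Longrightarrow> H n t x \<le> exp (\<bar>t\<bar> * real n)"
proof -
  assume x: "x \<in> X"
  have "t * (\<Sum>i<n. real (x i)) \<le> \<bar>t\<bar> * (\<Sum>i<n. real (x i))"
    by (intro mult_right_mono sum_nonneg) auto
  also have "(\<Sum>i<n. real (x i)) \<le> (\<Sum>i<n. 1)"
  proof (rule sum_mono)
    show "real (x i) \<le> 1" for i using X_digit[OF x, of i] by auto
  qed
  then have "\<bar>t\<bar> * (\<Sum>i<n. real (x i)) \<le> \<bar>t\<bar> * real n" by (intro mult_left_mono) auto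
  finally show ?thesis by (simp add: H_def)
qed

lemma growth_bound:
  assumes "growth_rate \<beta> t < ereal r"
  obtains \<rho> C where "bounded_growth \<beta> t \<rho> C" "\<rho> < r"
proof -
  define s where "s n = sup_norm \<beta> (\<lambda>x. exp (t * birkhoff n (indicator (cyl1 \<beta>)) x))" for n
  have s_eq: "s n = (SUP x\<in>X. H n t x)" for n
    unfolding s_def sup_norm_def by (intro SUP_cong) (auto simp: birkhoff_eq H_def)
  have H_le_s: "H n t x \<le> s n" if "x \<in> X" for n x
    unfolding s_eq using that H_le_exp by (intro cSUP_upper bdd_aboveI2)
  have s_ge: "1 \<le> s n" for n
    using H_le_s[OF zero_in_X, of n] by (simp add: H_def zero_digits_def)
  have s_le: "s n \<le> exp (\<bar>t\<bar> * real n)" for n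
    unfolding s_eq using zero_in_X H_le_exp by (intro cSUP_least) auto
  obtain \<rho> where \<rho>: "growth_rate \<beta> t < ereal \<rho>" "\<rho> < r"
    using ereal_dense2[OF assms] by auto
  have "limsup (\<lambda>n. ereal (root n (s n))) < ereal \<rho>"
    using \<rho>(1) by (simp add: growth_rate_def s_def)
  from Limsup_lessD[OF this] obtain N where N: "\<And>n. n \<ge> N \<Longrightarrow> root n (s n) < \<rho>"
    by (auto simp: eventually_sequentially)
  \<comment> \<open>The index 0 is avoided because \<open>root 0\<close> is constantly 0.\<close>
  define M where "M = max N 1"
  \<comment> \<open>The point \<open>zero_digits\<close> has weight 1 for every \<open>n\<close>, so
    \<open>s n\<close> is at least 1 and \<open>\<rho>\<close> exceeds 1. For \<open>n\<close> below
    \<open>M\<close> the factor \<open>\<rho> ^ n\<close> then does no harm, and \<open>C\<close>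
    alone absorbs \<open>s n\<close>.\<close>
  have "1 \<le> root M (s M)" using s_ge[of M] by (simp add: M_def)
  also have "\<dots> < \<rho>" using N[of M] by (simp add: M_def)
  finally have \<rho>1: "1 < \<rho>" .
  define C where "C = exp (\<bar>t\<bar> * real M)"
  have C1: "1 \<le> C" by (simp add: C_def)
  have "s n \<le> C * \<rho> ^ n" for n
  proof (cases "M \<le> n")
    case True
    then have "0 < n" by (simp add: M_def)
    have "s n = root n (s n) ^ n" using \<open>0 < n\<close> s_ge[of n] by simp
    also have "\<dots> \<le> \<rho> ^ n"
      using N[of n] True s_ge[of n] by (intro power_mono) (auto simp: M_def real_root_ge_zero)
    also have "\<dots> \<le> C * \<rho> ^ n" using C1 \<rho>1 mult_right_mono[of 1 C "\<rho> ^ n"] by simp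
    finally show ?thesis .
  next
    case False
    have "s n \<le> exp (\<bar>t\<bar> * real n)" by (rule s_le)
    also have "\<dots> \<le> C" using False by (simp add: C_def mult_left_mono)
    also have "\<dots> \<le> C * \<rho> ^ n" using C1 \<rho>1 mult_left_mono[of 1 "\<rho> ^ n" C] by simp
    finally show ?thesis .
  qed
  then have "bounded_growth \<beta> t \<rho> C"
    using H_le_s \<rho>1 by unfold_locales (meson order_trans, simp)
  then show ?thesis using that \<rho>(2) by blast
qed

end

theorem theorem3p7:
  fixes \<beta> t :: real and \<mu> :: complex
  assumes "1 < \<beta>" and "\<beta> \<le> 2"
    and "ereal (cmod \<mu>) > growth_rate \<beta> t"
  shows "isolated_eigenvalue \<beta> t \<mu> \<longleftrightarrow> 1 - phi \<beta> t (inverse \<mu>) = 0"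
proof -
  interpret beta_expansion \<beta> using assms by unfold_locales
  obtain \<rho> C where *: "bounded_growth \<beta> t \<rho> C" "\<rho> < cmod \<mu>"
    using growth_bound assms(3) by blast
  interpret bounded_growth \<beta> t \<rho> C by (rule *(1))
  show ?thesis
  proof
    assume "isolated_eigenvalue \<beta> t \<mu>"
    then have "\<mu> \<in> op_spectrum \<beta> t"
      using eigenvalue_in_spectrum by (simp add: isolated_eigenvalue_def)
    then show "1 - phi \<beta> t (inverse \<mu>) = 0" using not_in_spectrum[OF *(2)] by auto
  next
    assume "1 - phi \<beta> t (inverse \<mu>) = 0"
    then show "isolated_eigenvalue \<beta> t \<mu>" using isolated_if_phi[OF *(2)] by simp
  qed
qed

end
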